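(* Let $k\ge 1$, $0\le a\le k$ and $M\ge 1$ be integers with $M\not\equiv 0, \pm (k+1-a)\pmod{2k+3}$, and let $n\ge 1$ and $j\ge 0$ be integers. The number of partitions of $n$ into parts not congruent to $0,\pm (k+1-a)$ modulo $2k+3$ in which the part $M$ occurs exactly $j$ times is equal to the number of partitions $\lambda=(\lambda_1\ge\lambda_2\ge\cdots)$ of $n$ which are $(k+1,k+1-a)$-admissible, with $r\le k$ Durfee rectangles of sizes $$ n_1\times n_1,\ \ldots,\ n_{k-a}\times n_{k-a},\ (n_{k-a+1}+1)\times n_{k-a+1},\ \ldots,\ (n_r+1) \times n_r, $$ of the following form: (1) if $r=n_1=1$ and $0\le a<k$, then $\lambda$ is a single part of size $Mj$, $Mj+1,\ldots$, or $Mj+(M-1)$; (2) if $r=n_1=1$ and $a=k$, then $\lambda=(\lambda_1,1)$ has size $n$ equal to $Mj$, or to $Mj+i$ for some $2\le i\le M-1$, or to $Mj+(M+1)$; (3) if $n_1=1$ and $r\ge 2$, then $\lfloor (\lambda_1-n_1)/M \rfloor=j$; (4) if $n_1\ge 2$, then $\lfloor (\lambda_1-\lambda_2)/M \rfloor=j$.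
   Context: Sizes are (number of rows) $\times$ (number of columns). Let $k\ge1$ and $0\le a\le k$. A partition $\lambda$ (identified with its Ferrers diagram, parts as rows) is called $(k+1,k+1-a)$-admissible if all of its parts are covered by $r\le k$ successive Durfee rectangles, moving down, of sizes $$ n_1\times n_1,\ \ldots,\ n_{k-a}\times n_{k-a},\ (n_{k-a+1}+1)\times n_{k-a+1},\ \ldots,\ (n_r+1) \times n_r $$ with all $n_i\ge 1$, such that the $(n_1+n_2+\cdots+ n_{k-a+i}+i)$-th part of $\lambda$ equals $n_{k-a+i}$ for $1\le i\le r-(k-a)$. Here the first $\min(r,k-a)$ rectangles are Durfee squares and the remaining ones have one more row than columns; $r\le k-a$ is allowed, in which case all are squares. "Successive" means: the first rectangle is the largest rectangle of the prescribed shape ($m\times m$, respectively $(m+1)\times m$) that fits in the top left corner of the diagram of $\lambda$; each subsequent rectangle is the largest one of its prescribed shape that fits in the top left corner of the diagram consisting of the parts of $\lambda$ lying below the previous rectangles; and after the $r$-th rectangle no parts of $\lambda$ remain below. The parts of $\lambda$ to the right of the rectangles are otherwise unconstrained, so the extra condition says that in the last row of each non-square rectangle nothing lies to the right of the rectangle. For example, for $k=3$, $a=2$, the partition $(9,1)$ is not $(4,2)$-admissible. *)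

theory Defs
  imports Main "HOL-Number_Theory.Cong"
begin

text \<open>
  Partitions are weakly decreasing lists of positive parts; the part usually written
  \<open>\<lambda>\<^sub>i\<close> is \<open>xs ! (i - 1)\<close>.
\<close>

definition partitions :: "nat \<Rightarrow> nat list set" where
  "partitions n = {xs. sorted_wrt (\<ge>) xs \<and> (\<forall>x\<in>set xs. 0 < x) \<and> sum_list xs = n}"

definition ferrers :: "nat list \<Rightarrow> (nat \<times> nat) set" where
  "ferrers xs = {(i, j). i < length xs \<and> j < xs ! i}"

definition rect_fits :: "nat \<Rightarrow> nat \<Rightarrow> nat list \<Rightarrow> bool" where
  "rect_fits h w xs \<longleftrightarrow> {..<h} \<times> {..<w} \<subseteq> ferrers xs"

text \<open>
  \<open>largest_rect e m xs\<close>: the largest rectangle with \<open>m + e\<close> rows and \<open>m\<close> columns fitting in the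
  top left corner of the diagram is the one of width \<open>m\<close> (\<open>e = 0\<close> for Durfee squares, \<open>e = 1\<close>
  for rectangles with one more row than columns). A rectangle of width \<open>0\<close> is empty and always
  fits, also when \<open>e = 1\<close>.
\<close>

definition largest_rect :: "nat \<Rightarrow> nat \<Rightarrow> nat list \<Rightarrow> bool" where
  "largest_rect e m xs \<longleftrightarrow>
     rect_fits (m + e) m xs \<and> (\<forall>m'. rect_fits (m' + e) m' xs \<longrightarrow> m' \<le> m)"

text \<open>
  In the following, \<open>ns = [n\<^sub>1, \<dots>, n\<^sub>r]\<close>, so that \<open>r = length ns\<close> and
  \<open>n\<^sub>i = ns ! (i - 1)\<close>; the parameters are meant for \<open>a \<le> k\<close>.
\<close>

definition extra_row :: "nat \<Rightarrow> nat \<Rightarrow> nat \<Rightarrow> nat" where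
  "extra_row k a l = (if l < k - a then 0 else 1)"

definition rows_above :: "nat \<Rightarrow> nat \<Rightarrow> nat list \<Rightarrow> nat \<Rightarrow> nat" where
  "rows_above k a ns i = (\<Sum>l<i. ns ! l + extra_row k a l)"

definition durfee_dissection :: "nat \<Rightarrow> nat \<Rightarrow> nat list \<Rightarrow> nat list \<Rightarrow> bool" where
  "durfee_dissection k a ns xs \<longleftrightarrow>
     (\<forall>i<length ns. 1 \<le> ns ! i \<and>
        largest_rect (extra_row k a i) (ns ! i) (drop (rows_above k a ns i) xs)) \<and>
     rows_above k a ns (length ns) = length xs"

text \<open>
  The partition \<open>xs\<close> is \<open>(k + 1, k + 1 - a)\<close>-admissible, with Durfee rectangles of widths \<open>ns\<close>.
  Since the rectangles are chosen greedily, \<open>xs\<close> determines \<open>ns\<close>. In the last conjunct,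
  \<open>sum_list (take (k - a + i) ns) + i\<close> is \<open>n\<^sub>1 + \<dots> + n\<^bsub>k-a+i\<^esub> + i\<close>, the (one-based)
  index of the last row of the \<open>i\<close>-th non-square rectangle; the range of \<open>i\<close> is empty if
  \<open>length ns \<le> k - a\<close>.
\<close>

definition admissible_with :: "nat \<Rightarrow> nat \<Rightarrow> nat list \<Rightarrow> nat list \<Rightarrow> bool" where
  "admissible_with k a ns xs \<longleftrightarrow>
     length ns \<le> k \<and> durfee_dissection k a ns xs \<and>
     (\<forall>i\<in>{1..length ns - (k - a)}.
        xs ! (sum_list (take (k - a + i) ns) + i - 1) = ns ! (k - a + i - 1))"

text \<open>\<open>m\<close> is not congruent to \<open>0, \<plusminus>(k + 1 - a)\<close> modulo \<open>2k + 3\<close>.\<close>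

definition allowed_part :: "nat \<Rightarrow> nat \<Rightarrow> nat \<Rightarrow> bool" where
  "allowed_part k a m \<longleftrightarrow>
     \<not> [int m = 0] (mod (2 * int k + 3)) \<and>
     \<not> [int m = int k + 1 - int a] (mod (2 * int k + 3)) \<and>
     \<not> [int m = - (int k + 1 - int a)] (mod (2 * int k + 3))"

end

theory Submission
  imports Defs "HOL-Computational_Algebra.Formal_Laurent_Series" "HOL-Library.Multiset"
begin

text \<open>
  Everything rests on the Andrews--Gordon identity in its Durfee dissection form, theorem
  \<open>andrews_gordon\<close>: if \<open>b(n)\<close> is the number of admissible partitions of \<open>n\<close> and \<open>p(n)\<close> the number
  of partitions of \<open>n\<close> into allowed parts, then \<open>b(n) = p(n)\<close> for all \<open>n\<close>. The refinement by
  \<open>M\<close> and \<open>j\<close> follows by taking the same difference on both sides. Deleting \<open>t\<close> copies of \<open>M\<close>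
  shows that \<open>p(n - M t)\<close> partitions into allowed parts contain \<open>M\<close> at least \<open>t\<close> times, so that exactly
  \<open>j\<close> copies occur in \<open>p(n - M j) - p(n - M (j + 1))\<close> of them. On the admissible side the first part
  \<open>\<lambda>\<^sub>1\<close> can be moved freely above a lower bound (\<open>\<lambda>\<^sub>2\<close> if \<open>n\<^sub>1 \<ge> 2\<close>, and \<open>1\<close> if \<open>n\<^sub>1 = 1\<close>) without
  changing the rectangles. Hence the dissections whose first part exceeds that bound by at least \<open>t\<close>
  correspond to all dissections of \<open>n - t\<close>, and the quotient of the excess by \<open>M\<close> has value \<open>j\<close> for the same
  difference of counts. The dissections with no rectangle, or with just one rectangle of width \<open>1\<close>, have to be
  treated apart: there is at most one of each size (none of size \<open>1\<close> if \<open>a = k\<close>), and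
  conditions (1) and (2) are the same difference for this sequence of zeros and ones.

  The Andrews--Gordon identity is proved with the Bailey chain. Cutting off the first rectangle
  shows that the generating polynomial of the admissible partitions with parts at most \<open>N\<close> is a multiple
  sum built from \<open>q\<close>-binomial coefficients (\<open>sum_dissected_lists\<close>). Each summation in it is a step of the
  Bailey chain, that is, an application of the \<open>q\<close>-Vandermonde sum (\<open>q_vandermonde\<close>, \<open>bailey_step\<close>), and
  starting from the unit Bailey pair the multiple sum collapses to the single sum
  \<open>(q)\<^sub>N \<Sum>\<^sub>j (-1)\<^sup>j q\<^bsup>(k+1)j\<^sup>2+(a+1)j+j(j-1)/2\<^esup> / ((q)\<^bsub>N-j\<^esub> (q)\<^bsub>N+j\<^esub>)\<close>
  (\<open>chain_sum_gordon\<close>). The finite Jacobi triple product (\<open>finite_triple_product\<close>) in base \<open>q\<^bsup>2k+3\<^esup>\<close>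
  produces a sum with the same numerators, so for large \<open>N\<close> both sums are, up to any given power of \<open>q\<close>,
  the same theta series divided by \<open>(q)\<^sub>N\<close> and \<open>(q\<^bsup>2k+3\<^esup>; q\<^bsup>2k+3\<^esup>)\<^sub>N\<close>, respectively.

  The finite identities hold in every field for a nonzero \<open>q\<close> none of whose positive powers is \<open>1\<close>, and are then
  used for the indeterminate of the formal Laurent series; truncation takes place in formal power series.
\<close>

section \<open>The \<open>q\<close>-Vandermonde sum\<close>

definition qpoch :: "'a::comm_ring_1 \<Rightarrow> nat \<Rightarrow> 'a" where
  "qpoch q n = (\<Prod>i=1..n. 1 - q ^ i)"

text \<open>
  The reciprocal of \<open>(q)\<^sub>i\<close>, extended by \<open>0\<close> to negative \<open>i\<close>. With this convention summation ranges may be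
  enlarged at will, and \<open>rq_pred\<close> below holds for all integers.
\<close>
definition rqpoch :: "'a::field \<Rightarrow> int \<Rightarrow> 'a" where
  "rqpoch q i = (if i < 0 then 0 else inverse (qpoch q (nat i)))"

lemma qpoch_0 [simp]: "qpoch q 0 = 1"
  by (simp add: qpoch_def)

lemma qpoch_Suc: "qpoch q (Suc n) = qpoch q n * (1 - q ^ Suc n)"
  by (simp add: qpoch_def)

lemma rqpoch_neg [simp]: "i < 0 \<Longrightarrow> rqpoch q i = 0"
  by (simp add: rqpoch_def)

lemma rqpoch_0 [simp]: "rqpoch q 0 = 1"
  by (simp add: rqpoch_def)

lemma rqpoch_of_nat: "rqpoch q (int n) = inverse (qpoch q n)"
  by (simp add: rqpoch_def)

locale not_root_of_unity =
  fixes q :: "'a::field"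
  assumes nonzero: "q \<noteq> 0" and power_neq_1: "0 < n \<Longrightarrow> q ^ n \<noteq> 1"
begin

abbreviation rq :: "int \<Rightarrow> 'a" where
  "rq \<equiv> rqpoch q"

lemma qpoch_nonzero: "qpoch q n \<noteq> 0"
  by (induction n) (use power_neq_1[of "Suc _"] in \<open>auto simp: qpoch_Suc simp del: power_Suc\<close>)

lemma rq_pred: "rq (i - 1) = (1 - q powi i) * rq i"
proof (cases "i \<le> 0")
  case True
  then show ?thesis by (cases "i = 0") auto
next
  case False
  then obtain n where n: "i = int (Suc n)"
    by (metis nat_0_le not_le_imp_less order_less_imp_le zero_less_imp_eq_int less_imp_Suc_add plus_nat.add_0)
  have "rq i = inverse (qpoch q n * (1 - q ^ Suc n))"
    using n by (simp add: rqpoch_def qpoch_Suc nat_add_distrib del: power_Suc)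
  moreover have "rq (i - 1) = inverse (qpoch q n)"
    using n by (simp add: rqpoch_def)
  moreover have "q powi i = q ^ Suc n"
    using n by (simp only: power_int_of_nat)
  moreover have "1 - q ^ Suc n \<noteq> 0"
    using power_neq_1[of "Suc n"] by simp
  ultimately show ?thesis
    by (simp add: inverse_mult_distrib del: power_Suc)
qed

text \<open>
  Multiply the sum by \<open>1 - q\<^bsup>m+1\<^esup> = (1 - q\<^bsup>m+1-t\<^esup>) + q\<^bsup>m+1-t\<^esup> (1 - q\<^sup>t)\<close>, term by term. Either factor cancels
  against one of the reciprocals; the first part gives the sum for \<open>m\<close> and \<open>c\<close>, the second one, shifted
  by one, the sum for \<open>m\<close> and \<open>c + 1\<close>.
\<close>
lemma q_vandermonde_nat:
  "(\<Sum>t\<in>{0..int m}. q powi (t * (t + int c)) * rq t * rq (int m - t) * rq (t + int c))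
     = rq (int m) * rq (int m + int c)"
proof (induction m arbitrary: c)
  case 0
  show ?case by simp
next
  case (Suc m)
  define M where "M = int (Suc m)"
  define F where "F t = q powi (t * (t + int c)) * rq t * rq (int m - t) * rq (t + int c)" for t
  define G where
    "G t = q powi (t * (t + int c) + M - t) * rq (t - 1) * rq (M - t) * rq (t + int c)" for t
  let ?S = "\<Sum>t\<in>{0..M}. q powi (t * (t + int c)) * rq t * rq (M - t) * rq (t + int c)"
  have M: "M = int m + 1" by (simp add: M_def)
  have "(1 - q powi M) * ?S = (\<Sum>t\<in>{0..M}. F t + G t)"
    unfolding sum_distrib_left
  proof (rule sum.cong)
    fix t
    have 1: "rq (int m - t) = (1 - q powi (M - t)) * rq (M - t)"
      using rq_pred[of "M - t"] by (simp add: M algebra_simps)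
    have 2: "q powi (t * (t + int c) + M - t) = q powi (t * (t + int c)) * q powi (M - t)"
      using nonzero by (simp add: power_int_add[symmetric] algebra_simps)
    have 3: "q powi M = q powi (M - t) * q powi t"
      using nonzero by (simp add: power_int_add[symmetric])
    show "(1 - q powi M) * (q powi (t * (t + int c)) * rq t * rq (M - t) * rq (t + int c)) = F t + G t"
      unfolding F_def G_def 1 2 3 rq_pred[of t] by (simp add: algebra_simps)
  qed simp
  also have "\<dots> = sum F {0..M} + sum G {0..M}"
    by (rule sum.distrib)
  also have "sum F {0..M} = sum F {0..int m}"
    by (rule sum.mono_neutral_right) (auto simp: F_def M)
  also have "\<dots> = rq (int m) * rq (int m + int c)"
    unfolding F_def by (rule Suc.IH)
  also have "sum G {0..M} = (\<Sum>t\<in>{0..int m}. G (t + 1))"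
    by (rule sum.reindex_bij_witness_not_neutral
          [where S' = "{0}" and T' = "{}" and i = "\<lambda>t. t + 1" and j = "\<lambda>t. t - 1"])
       (auto simp: G_def M)
  also have "\<dots> = q powi (M + int c) *
      (\<Sum>t\<in>{0..int m}. q powi (t * (t + int (Suc c))) * rq t * rq (int m - t) * rq (t + int (Suc c)))"
    unfolding sum_distrib_left
  proof (rule sum.cong)
    fix t
    have "q powi ((t + 1) * (t + 1 + int c) + M - (t + 1)) =
        q powi (M + int c) * q powi (t * (t + int (Suc c)))"
      using nonzero by (simp add: power_int_add[symmetric] algebra_simps)
    then show "G (t + 1) = q powi (M + int c) *
        (q powi (t * (t + int (Suc c))) * rq t * rq (int m - t) * rq (t + int (Suc c)))"
      by (simp add: G_def M algebra_simps)
  qed simp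
  also have "\<dots> = q powi (M + int c) * (rq (int m) * rq (int m + int (Suc c)))"
    by (simp only: Suc.IH)
  also have "rq (int m + int c) = (1 - q powi (M + int c)) * rq (M + int c)"
    using rq_pred[of "M + int c"] by (simp add: M algebra_simps)
  also have "int m + int (Suc c) = M + int c"
    by (simp add: M)
  also have "rq (int m) = (1 - q powi M) * rq M"
    using rq_pred[of M] by (simp add: M)
  finally have "(1 - q powi M) * ?S = (1 - q powi M) * (rq M * rq (M + int c))"
    by (simp add: algebra_simps)
  moreover have "1 - q powi M \<noteq> 0"
    using power_neq_1[of "Suc m"] unfolding M_def power_int_of_nat by simp
  ultimately show ?case
    by (simp add: M_def)
qed

text \<open>
  The choice \<open>u = j\<close>, \<open>v = - j - e\<close> turns the exponent into \<open>s (s + e) - j (j + e)\<close>, which is what the Bailey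
  chain needs. The terms with \<open>s < max u v\<close> vanish, so that the sum may start at any \<open>lo\<close> up to there.
\<close>
lemma q_vandermonde:
  assumes "lo \<le> max u v"
  shows "(\<Sum>s\<in>{lo..N}. q powi ((s - u) * (s - v)) * rq (N - s) * rq (s - u) * rq (s - v))
    = rq (N - u) * rq (N - v)"
  using assms
proof (induction u v rule: linorder_wlog)
  case (sym u v)
  then show ?case by (simp add: mult_ac max.commute)
next
  case (le v u)
  show ?case
  proof (cases "N < u")
    case True
    then show ?thesis using le by (auto intro!: sum.neutral)
  next
    case False
    define m c where "m = nat (N - u)" and "c = nat (u - v)"
    have mc: "N = u + int m" "u = v + int c"
      using False le by (auto simp: m_def c_def)
    have "(\<Sum>s\<in>{lo..N}. q powi ((s - v) * (s - u)) * rq (N - s) * rq (s - v) * rq (s - u)) =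
        (\<Sum>t\<in>{0..int m}. q powi (t * (t + int c)) * rq t * rq (int m - t) * rq (t + int c))"
      by (rule sum.reindex_bij_witness_not_neutral
          [where S' = "{lo..<u}" and T' = "{}" and i = "\<lambda>t. t + u" and j = "\<lambda>t. t - u"])
         (use le in \<open>auto simp: mc algebra_simps\<close>)
    also have "\<dots> = rq (N - v) * rq (N - u)"
      unfolding q_vandermonde_nat by (simp add: mc algebra_simps)
    finally show ?thesis .
  qed
qed

section \<open>Bailey chain\<close>

text \<open>
  If \<open>\<beta>\<^sub>N\<close> denotes this sum, then \<open>(\<alpha>, \<beta>)\<close> is a bilateral form of a Bailey pair, relative to \<open>1\<close> for \<open>e = 0\<close>
  and, up to normalization, relative to \<open>q\<close> for \<open>e = 1\<close>.
\<close>
definition bailey_sum :: "nat \<Rightarrow> (int \<Rightarrow> 'a) \<Rightarrow> nat \<Rightarrow> 'a" where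
  "bailey_sum e \<alpha> N =
     (\<Sum>j\<in>{- int (N + e)..int N}. \<alpha> j * rq (int N - j) * rq (int (N + e) + j))"

lemma bailey_sum_extend:
  assumes "s \<le> N"
  shows "bailey_sum e \<alpha> s =
    (\<Sum>j\<in>{- int (N + e)..int N}. \<alpha> j * rq (int s - j) * rq (int (s + e) + j))"
  unfolding bailey_sum_def
  by (rule sum.mono_neutral_left) (use assms in \<open>auto simp: not_le\<close>)

text \<open>
  Exchange the summations; the sum over \<open>s\<close> is then the \<open>q\<close>-Vandermonde sum. The restriction on \<open>e\<close>
  ensures \<open>max j (- j - e) \<ge> 0\<close>, so that no term is lost by starting at \<open>s = 0\<close>.
\<close>
lemma bailey_step:
  assumes "e \<le> 1"
  shows "(\<Sum>s\<le>N. q ^ (s * (s + e)) * rq (int N - int s) * bailey_sum e \<alpha> s) =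
    bailey_sum e (\<lambda>j. q powi (j * (j + int e)) * \<alpha> j) N"
proof -
  let ?J = "{- int (N + e)..int N}"
  have "(\<Sum>s\<le>N. q ^ (s * (s + e)) * rq (int N - int s) * bailey_sum e \<alpha> s) =
      (\<Sum>s\<le>N. \<Sum>j\<in>?J. q powi (int s * (int s + int e)) * rq (int N - int s) *
         (\<alpha> j * rq (int s - j) * rq (int (s + e) + j)))"
  proof (rule sum.cong)
    fix s assume "s \<in> {..N}"
    then have s: "s \<le> N" by simp
    have "q powi (int s * (int s + int e)) = q ^ (s * (s + e))"
      unfolding power_int_of_nat[symmetric] by simp
    then show "q ^ (s * (s + e)) * rq (int N - int s) * bailey_sum e \<alpha> s =
        (\<Sum>j\<in>?J. q powi (int s * (int s + int e)) * rq (int N - int s) *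
         (\<alpha> j * rq (int s - j) * rq (int (s + e) + j)))"
      unfolding bailey_sum_extend[OF s] by (simp add: sum_distrib_left)
  qed simp
  also have "\<dots> = (\<Sum>j\<in>?J. \<Sum>s\<le>N. q powi (int s * (int s + int e)) * rq (int N - int s) *
         (\<alpha> j * rq (int s - j) * rq (int (s + e) + j)))"
    by (rule sum.swap)
  also have "\<dots> = (\<Sum>j\<in>?J. q powi (j * (j + int e)) * \<alpha> j * rq (int N - j) * rq (int (N + e) + j))"
  proof (rule sum.cong)
    fix j assume "j \<in> ?J"
    let ?g = "\<lambda>s. q powi ((s - j) * (s - (- j - int e))) * rq (int N - s) * rq (s - j) *
        rq (s - (- j - int e))"
    have "(\<Sum>s\<le>N. q powi (int s * (int s + int e)) * rq (int N - int s) *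
         (\<alpha> j * rq (int s - j) * rq (int (s + e) + j))) =
        (\<Sum>s\<le>N. q powi (j * (j + int e)) * \<alpha> j * ?g (int s))"
    proof (rule sum.cong)
      fix s
      have "q powi (int s * (int s + int e)) =
          q powi (j * (j + int e)) * q powi ((int s - j) * (int s - (- j - int e)))"
        using nonzero by (simp add: power_int_add[symmetric] algebra_simps)
      then show "q powi (int s * (int s + int e)) * rq (int N - int s) *
         (\<alpha> j * rq (int s - j) * rq (int (s + e) + j)) = q powi (j * (j + int e)) * \<alpha> j * ?g (int s)"
        by (simp add: algebra_simps)
    qed simp
    also have "\<dots> = q powi (j * (j + int e)) * \<alpha> j * (\<Sum>s\<le>N. ?g (int s))"
      by (simp add: sum_distrib_left)
    also have "(\<Sum>s\<le>N. ?g (int s)) = (\<Sum>s\<in>{0..int N}. ?g s)"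
      by (rule sum.reindex_bij_witness[where i = nat and j = int]) auto
    also have "\<dots> = rq (int N - j) * rq (int N - (- j - int e))"
      by (rule q_vandermonde) (use assms in auto)
    finally show "(\<Sum>s\<le>N. q powi (int s * (int s + int e)) * rq (int N - int s) *
         (\<alpha> j * rq (int s - j) * rq (int (s + e) + j))) =
        q powi (j * (j + int e)) * \<alpha> j * rq (int N - j) * rq (int (N + e) + j)"
      by (simp add: algebra_simps)
  qed simp
  finally show ?thesis
    unfolding bailey_sum_def .
qed

end

section \<open>Finite Jacobi triple product\<close>

definition tri :: "int \<Rightarrow> int" where
  "tri j = j * (j - 1) div 2"

lemma two_tri: "2 * tri j = j * (j - 1)"
  by (simp add: tri_def)

lemma tri_add_1: "tri (j + 1) = tri j + j"
  using two_tri[of j] two_tri[of "j + 1"] by (simp add: algebra_simps)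

lemma tri_diff_1: "tri (j - 1) = tri j - (j - 1)"
  using tri_add_1[of "j - 1"] by simp

lemma tri_reflect: "tri (- 1 - j) = tri j + 2 * j + 1"
  using two_tri[of j] two_tri[of "- 1 - j"] by (simp add: algebra_simps)

context not_root_of_unity
begin

text \<open>
  The decomposition \<open>1 - q\<^bsup>2s\<^esup> = (1 - q\<^bsup>s+j\<^esup>) + q\<^bsup>s+j\<^esup> (1 - q\<^bsup>s-j\<^esup>)\<close> lowers one of the two indices in each
  term. After a shift of \<open>j\<close> both halves are multiples of the same sum \<open>U\<close>, with factors \<open>1\<close> and \<open>- q\<^sup>s / z\<close>.
  A second step of this kind leads from \<open>U\<close> to the sum for \<open>s - 1 = N\<close>.
\<close>
lemma triple_product_step:
  fixes z :: 'a
  assumes z: "z \<noteq> 0"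
  defines "\<theta> \<equiv> \<lambda>j. (- 1) powi j * z powi j * q powi tri j"
  shows "(1 - q ^ (2 * N + 2)) * (1 - q ^ (2 * N + 1)) * bailey_sum 0 \<theta> (Suc N) =
    (1 - q ^ (N + 1) / z) * (1 - z * q ^ N) * bailey_sum 0 \<theta> N"
proof -
  define s where "s = int N + 1"
  have s: "int N = s - 1" by (simp add: s_def)
  let ?J = "{- s..s}"
  define U where "U = (\<Sum>j\<in>?J. \<theta> j * rq (s - j) * rq (s + j - 1))"
  have T: "bailey_sum 0 \<theta> (Suc N) = (\<Sum>j\<in>?J. \<theta> j * rq (s - j) * rq (s + j))"
    by (simp add: bailey_sum_def s_def add.commute)
  have T': "bailey_sum 0 \<theta> N = (\<Sum>j\<in>?J. \<theta> j * rq (s - 1 - j) * rq (s - 1 + j))"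
    unfolding bailey_sum_def s add_0_right
    by (rule sum.mono_neutral_left) (auto simp: s_def)
  have prev: "\<theta> (j - 1) * q powi (j - 1) = - (\<theta> j / z)" for j
    using z nonzero
    by (simp add: \<theta>_def tri_diff_1 power_int_diff)
  have succ: "\<theta> (j + 1) = - (z * \<theta> j * q powi j)" for j
    using z nonzero
    by (simp add: \<theta>_def tri_add_1 power_int_add)
  have "(1 - q powi (2 * s)) * bailey_sum 0 \<theta> (Suc N) =
      (\<Sum>j\<in>?J. \<theta> j * rq (s - j) * rq (s + j - 1) +
         \<theta> j * q powi (s + j) * rq (s - j - 1) * rq (s + j))"
    unfolding T sum_distrib_left
  proof (rule sum.cong)
    fix j
    have "q powi (2 * s) = q powi (s - j) * q powi (s + j)"
      using nonzero by (simp add: power_int_add[symmetric])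
    then show "(1 - q powi (2 * s)) * (\<theta> j * rq (s - j) * rq (s + j)) =
        \<theta> j * rq (s - j) * rq (s + j - 1) + \<theta> j * q powi (s + j) * rq (s - j - 1) * rq (s + j)"
      unfolding rq_pred by (simp add: algebra_simps)
  qed simp
  also have "\<dots> = U + (\<Sum>j\<in>?J. \<theta> j * q powi (s + j) * rq (s - j - 1) * rq (s + j))"
    by (simp add: sum.distrib U_def)
  also have "(\<Sum>j\<in>?J. \<theta> j * q powi (s + j) * rq (s - j - 1) * rq (s + j)) =
      (\<Sum>j\<in>?J. \<theta> (j - 1) * q powi (s + (j - 1)) * rq (s - (j - 1) - 1) * rq (s + (j - 1)))"
    by (rule sum.reindex_bij_witness_not_neutral
          [where S' = "{s}" and T' = "{- s}" and i = "\<lambda>t. t - 1" and j = "\<lambda>t. t + 1"]) auto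
  also have "\<dots> = (\<Sum>j\<in>?J. - (q powi s / z) * (\<theta> j * rq (s - j) * rq (s + j - 1)))"
  proof (rule sum.cong)
    fix j
    have "\<theta> (j - 1) * q powi (s + (j - 1)) = q powi s * (\<theta> (j - 1) * q powi (j - 1))"
      using nonzero by (subst power_int_add) auto
    also have "\<dots> = - (q powi s / z) * \<theta> j"
      by (simp add: prev)
    finally show "\<theta> (j - 1) * q powi (s + (j - 1)) * rq (s - (j - 1) - 1) * rq (s + (j - 1)) =
        - (q powi s / z) * (\<theta> j * rq (s - j) * rq (s + j - 1))"
      by (simp add: algebra_simps)
  qed simp
  also have "U + \<dots> = (1 - q powi s / z) * U"
    unfolding U_def sum_distrib_left[symmetric] by (simp add: algebra_simps)
  finally have even_step: "(1 - q powi (2 * s)) * bailey_sum 0 \<theta> (Suc N) = (1 - q powi s / z) * U" .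
  have "(1 - q powi (2 * s - 1)) * U =
      (\<Sum>j\<in>?J. \<theta> j * rq (s - j - 1) * rq (s + j - 1) +
         \<theta> j * q powi (s - j) * rq (s - j) * rq (s + j - 1 - 1))"
    unfolding U_def sum_distrib_left
  proof (rule sum.cong)
    fix j
    have "q powi (2 * s - 1) = q powi (s - j) * q powi (s + j - 1)"
      using nonzero by (simp add: power_int_add[symmetric])
    then show "(1 - q powi (2 * s - 1)) * (\<theta> j * rq (s - j) * rq (s + j - 1)) =
        \<theta> j * rq (s - j - 1) * rq (s + j - 1) + \<theta> j * q powi (s - j) * rq (s - j) * rq (s + j - 1 - 1)"
      unfolding rq_pred[of "s - j"] rq_pred[of "s + j - 1"] by (simp add: algebra_simps)
  qed simp
  also have "\<dots> = bailey_sum 0 \<theta> N +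
      (\<Sum>j\<in>?J. \<theta> j * q powi (s - j) * rq (s - j) * rq (s + j - 1 - 1))"
    by (simp add: sum.distrib T' algebra_simps)
  also have "(\<Sum>j\<in>?J. \<theta> j * q powi (s - j) * rq (s - j) * rq (s + j - 1 - 1)) =
      (\<Sum>j\<in>?J. \<theta> (j + 1) * q powi (s - (j + 1)) * rq (s - (j + 1)) * rq (s + (j + 1) - 1 - 1))"
    by (rule sum.reindex_bij_witness_not_neutral
          [where S' = "{- s}" and T' = "{s}" and i = "\<lambda>t. t + 1" and j = "\<lambda>t. t - 1"]) auto
  also have "\<dots> = (\<Sum>j\<in>?J. - (z * q powi (s - 1)) * (\<theta> j * rq (s - 1 - j) * rq (s - 1 + j)))"
  proof (rule sum.cong)
    fix j
    have "q powi (s - 1) = q powi j * q powi (s - (j + 1))"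
      using nonzero by (simp add: power_int_add[symmetric])
    then show "\<theta> (j + 1) * q powi (s - (j + 1)) * rq (s - (j + 1)) * rq (s + (j + 1) - 1 - 1) =
        - (z * q powi (s - 1)) * (\<theta> j * rq (s - 1 - j) * rq (s - 1 + j))"
      unfolding succ by (simp add: algebra_simps)
  qed simp
  also have "bailey_sum 0 \<theta> N + \<dots> = (1 - z * q powi (s - 1)) * bailey_sum 0 \<theta> N"
    unfolding T' sum_distrib_left[symmetric] by (simp add: algebra_simps)
  finally have odd_step:
    "(1 - q powi (2 * s - 1)) * U = (1 - z * q powi (s - 1)) * bailey_sum 0 \<theta> N" .
  have pows: "q powi (2 * s) = q ^ (2 * N + 2)" "q powi (2 * s - 1) = q ^ (2 * N + 1)"
    "q powi s = q ^ (N + 1)" "q powi (s - 1) = q ^ N"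
    unfolding power_int_of_nat[symmetric] by (simp_all add: s_def algebra_simps)
  have "(1 - q powi (2 * s)) * (1 - q powi (2 * s - 1)) * bailey_sum 0 \<theta> (Suc N) =
      (1 - q powi (2 * s - 1)) * ((1 - q powi (2 * s)) * bailey_sum 0 \<theta> (Suc N))"
    by (simp only: mult_ac)
  also have "\<dots> = (1 - q powi s / z) * ((1 - q powi (2 * s - 1)) * U)"
    unfolding even_step by (simp only: mult_ac)
  also have "\<dots> = (1 - q powi s / z) * (1 - z * q powi (s - 1)) * bailey_sum 0 \<theta> N"
    unfolding odd_step by (simp only: mult_ac)
  finally show ?thesis unfolding pows .
qed

theorem finite_triple_product:
  assumes z: "z \<noteq> 0"
  shows "qpoch q (2 * N) * bailey_sum 0 (\<lambda>j. (- 1) powi j * z powi j * q powi tri j) N =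
    (\<Prod>i=1..N. (1 - q ^ i / z) * (1 - z * q ^ (i - 1)))"
proof (induction N)
  case 0
  show ?case by (simp add: bailey_sum_def tri_def)
next
  case (Suc N)
  let ?T = "bailey_sum 0 (\<lambda>j. (- 1) powi j * z powi j * q powi tri j)"
  have "qpoch q (2 * Suc N) = qpoch q (2 * N) * ((1 - q ^ (2 * N + 2)) * (1 - q ^ (2 * N + 1)))"
    by (simp add: qpoch_Suc mult_ac)
  then have "qpoch q (2 * Suc N) * ?T (Suc N) =
      qpoch q (2 * N) * ((1 - q ^ (2 * N + 2)) * (1 - q ^ (2 * N + 1)) * ?T (Suc N))"
    by (simp only: mult_ac)
  also have "\<dots> = (1 - q ^ (N + 1) / z) * (1 - z * q ^ N) * (qpoch q (2 * N) * ?T N)"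
    unfolding triple_product_step[OF z] by (simp only: mult_ac)
  also have "\<dots> = (\<Prod>i=1..Suc N. (1 - q ^ i / z) * (1 - z * q ^ (i - 1)))"
    unfolding Suc.IH by (simp add: mult_ac)
  finally show ?case .
qed

section \<open>Evaluation of the multiple sum\<close>

definition gordon_coeff :: "nat \<Rightarrow> nat \<Rightarrow> int \<Rightarrow> 'a" where
  "gordon_coeff b c j = (- 1) powi j * q powi (int b * (j * j) + int c * j + tri j)"

text \<open>
  The unit Bailey pair is the triple product at \<open>z = 1\<close>, which vanishes because of its factor \<open>1 - z\<close>.
\<close>
lemma bailey_sum_unit: "bailey_sum 0 (gordon_coeff 0 0) N = (if N = 0 then 1 else 0)"
proof -
  have "gordon_coeff 0 0 = (\<lambda>j. (- 1) powi j * 1 powi j * q powi tri j)"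
    by (simp add: gordon_coeff_def fun_eq_iff)
  then have "qpoch q (2 * N) * bailey_sum 0 (gordon_coeff 0 0) N =
      (\<Prod>i=1..N. (1 - q ^ i / 1) * (1 - 1 * q ^ (i - 1)))"
    using finite_triple_product[of 1 N] by simp
  also have "\<dots> = (if N = 0 then 1 else 0)"
    \<comment> \<open>for \<open>N > 0\<close> the second factor with \<open>i = 1\<close> vanishes\<close>
    by (auto intro!: bexI[of _ 1])
  finally show ?thesis
    using qpoch_nonzero[of "2 * N"] by (auto split: if_splits)
qed

text \<open>
  This passes from Bailey pairs relative to \<open>q\<close> to those relative to \<open>1\<close> and is the point where the two
  kinds of rectangles meet. By \<open>rq_pred\<close> the sums differ by \<open>\<Sum>\<^sub>j h j\<close>, and the summand \<open>h\<close> is antisymmetric under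
  \<open>j \<mapsto> - 1 - j\<close>, since \<open>b (j\<^sup>2 + j)\<close> is invariant and \<open>j (j - 1) / 2 + j\<close> is, too, while the sign changes.
\<close>
lemma bailey_sum_shift: "bailey_sum 1 (gordon_coeff b b) N = bailey_sum 0 (gordon_coeff b b) N"
proof -
  let ?J = "{- int (N + 1)..int N}"
  define h where "h j = gordon_coeff b b j * q powi (int N + 1 + j) * rq (int N - j) * rq (int N + 1 + j)" for j
  have "bailey_sum 1 (gordon_coeff b b) N =
      (\<Sum>j\<in>?J. gordon_coeff b b j * rq (int N - j) * rq (int N + j) + h j)"
    unfolding bailey_sum_def
  proof (rule sum.cong)
    fix j
    have "rq (int N + j) = (1 - q powi (int N + 1 + j)) * rq (int N + 1 + j)"
      using rq_pred[of "int N + 1 + j"] by (simp add: algebra_simps)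
    then show "gordon_coeff b b j * rq (int N - j) * rq (int (N + 1) + j) =
        gordon_coeff b b j * rq (int N - j) * rq (int N + j) + h j"
      unfolding h_def by (simp only: of_nat_add of_nat_1) (simp add: algebra_simps)
  qed simp
  also have "\<dots> = (\<Sum>j\<in>?J. gordon_coeff b b j * rq (int N - j) * rq (int N + j)) + sum h ?J"
    by (rule sum.distrib)
  also have "(\<Sum>j\<in>?J. gordon_coeff b b j * rq (int N - j) * rq (int N + j)) =
      bailey_sum 0 (gordon_coeff b b) N"
    unfolding bailey_sum_def by (rule sum.mono_neutral_cong_right) auto
  also have "sum h ?J = 0"
  proof -
    have anti: "h (- 1 - j) = - h j" for j
    proof -
      have m: "(- 1 :: 'a) powi (- 1 - j) = - ((- 1) powi j)"
        using power_int_minus_one_minus[of "1 + j", where 'a = 'a] by (simp add: power_int_add)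
      have e: "int b * ((- 1 - j) * (- 1 - j)) + int b * (- 1 - j) + tri (- 1 - j) + (int N - j)
          = int b * (j * j) + int b * j + tri j + (int N + 1 + j)"
        by (simp add: tri_reflect algebra_simps)
      have h_alt: "h i = (- 1) powi i * q powi (int b * (i * i) + int b * i + tri i + (int N + 1 + i))
          * rq (int N - i) * rq (int N + 1 + i)" for i
        unfolding h_def gordon_coeff_def using nonzero
        by (subst power_int_add[of q _ "int N + 1 + i"]) (auto simp: mult_ac)
      have r1: "int N - (- 1 - j) = int N + 1 + j" and r2: "int N + 1 + (- 1 - j) = int N - j"
        by auto
      show ?thesis
        unfolding h_alt[of j] h_alt[of "- 1 - j"] r1 r2 e m by (simp add: mult_ac)
    qed
    have "?J = {0..int N} \<union> {- int (N + 1)..-1}" by auto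
    then have "sum h ?J = sum h {0..int N} + sum h {- int (N + 1)..-1}"
      by (simp only:) (rule sum.union_disjoint; auto)
    also have "sum h {- int (N + 1)..-1} = (\<Sum>j\<in>{0..int N}. h (- 1 - j))"
      by (rule sum.reindex_bij_witness[where i = "\<lambda>j. - 1 - j" and j = "\<lambda>j. - 1 - j"]) auto
    also have "\<dots> = - sum h {0..int N}"
      by (simp add: anti sum_negf)
    finally show ?thesis by simp
  qed
  finally show ?thesis by simp
qed

text \<open>
  \<open>\<Sum> q\<^bsup>\<Sum> s\<^sub>i (s\<^sub>i + e\<^sub>i)\<^esup> / ((q)\<^bsub>N-s\<^sub>1\<^esub> (q)\<^bsub>s\<^sub>1-s\<^sub>2\<^esub> \<dots> (q)\<^bsub>s\<^sub>r\<^esub>)\<close> over \<open>N \<ge> s\<^sub>1 \<ge> \<dots> \<ge> s\<^sub>r \<ge> 0\<close>.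
\<close>
fun chain_sum :: "nat list \<Rightarrow> nat \<Rightarrow> 'a" where
  "chain_sum [] N = rq (int N)"
| "chain_sum (e # es) N =
     (\<Sum>s\<le>N. q ^ (s * (s + e)) * rq (int N - int s) * chain_sum es s)"

lemma gordon_coeff_step:
  "q powi (j * (j + 0)) * gordon_coeff b c j = gordon_coeff (Suc b) c j"
  "q powi (j * (j + 1)) * gordon_coeff b c j = gordon_coeff (Suc b) (Suc c) j"
  unfolding gordon_coeff_def mult.left_commute[of _ "(- 1) powi j"]
  using nonzero by (simp_all add: power_int_add[symmetric] algebra_simps)

lemma bailey_step_square:
  "(\<Sum>s\<le>N. q ^ (s * s) * rq (int N - int s) * bailey_sum 0 (gordon_coeff b c) s) =
    bailey_sum 0 (gordon_coeff (Suc b) c) N"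
  using bailey_step[of 0 N "gordon_coeff b c"] by (simp add: gordon_coeff_step[simplified])

lemma bailey_step_oblong:
  "(\<Sum>s\<le>N. q ^ (s * (s + 1)) * rq (int N - int s) * bailey_sum 0 (gordon_coeff b b) s) =
    bailey_sum 0 (gordon_coeff (Suc b) (Suc b)) N"
proof -
  have "(\<Sum>s\<le>N. q ^ (s * (s + 1)) * rq (int N - int s) * bailey_sum 1 (gordon_coeff b b) s) =
      bailey_sum 1 (gordon_coeff (Suc b) (Suc b)) N"
    unfolding bailey_step[OF order_refl] of_nat_1 gordon_coeff_step ..
  then show ?thesis
    unfolding bailey_sum_shift .
qed

text \<open>
  Since \<open>bailey_sum 0 (gordon_coeff 0 0)\<close> is \<open>1\<close> at \<open>0\<close> and vanishes elsewhere, one step of the chain starting there leaves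
  just the term \<open>s = 0\<close>, which is the empty chain \<open>1 / (q)\<^sub>N\<close>.
\<close>
lemma chain_sum_oblong:
  "chain_sum (replicate a 1) N = bailey_sum 0 (gordon_coeff (Suc a) (Suc a)) N"
proof (induction a arbitrary: N)
  case 0
  have "bailey_sum 0 (gordon_coeff 1 1) N =
      (\<Sum>s\<le>N. if s = 0 then rq (int N) else 0)"
    unfolding One_nat_def bailey_step_oblong[symmetric] bailey_sum_unit
    by (rule sum.cong) auto
  then show ?case by (simp add: sum.delta)
next
  case (Suc a)
  then show ?case
    using bailey_step_oblong[of N "Suc a"] by simp
qed

lemma chain_sum_gordon:
  "chain_sum (replicate l 0 @ replicate a 1) N =
    bailey_sum 0 (gordon_coeff (Suc (l + a)) (Suc a)) N"
proof (induction l arbitrary: N)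
  case 0
  show ?case using chain_sum_oblong by simp
next
  case (Suc l)
  then show ?case
    using bailey_step_square[of N "Suc (l + a)" "Suc a"] by simp
qed

end

section \<open>Partitions in a box\<close>

definition box_lists :: "nat \<Rightarrow> nat \<Rightarrow> nat \<Rightarrow> nat list set" where
  "box_lists s lo hi = {us. length us = s \<and> sorted_wrt (\<ge>) us \<and> set us \<subseteq> {lo..hi}}"

lemma finite_box_lists [simp]: "finite (box_lists s lo hi)"
proof (rule finite_subset)
  show "box_lists s lo hi \<subseteq> {us. set us \<subseteq> {lo..hi} \<and> length us = s}"
    by (auto simp: box_lists_def)
qed (simp add: finite_lists_length_eq)

lemma box_lists_0: "box_lists 0 lo hi = {[]}"
  by (auto simp: box_lists_def)

lemma box_lists_singleton: "box_lists s lo lo = {replicate s lo}"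
  by (auto simp: box_lists_def sorted_wrt_iff_nth_less
      intro!: replicate_eqI)

lemma box_lists_Suc:
  assumes "lo \<le> h"
  shows "box_lists (Suc s) lo (Suc h) =
    box_lists (Suc s) lo h \<union> (#) (Suc h) ` box_lists s lo (Suc h)"
proof (intro equalityI subsetI)
  fix us assume us: "us \<in> box_lists (Suc s) lo (Suc h)"
  then obtain u us' where u: "us = u # us'"
    by (auto simp: box_lists_def length_Suc_conv)
  show "us \<in> box_lists (Suc s) lo h \<union> (#) (Suc h) ` box_lists s lo (Suc h)"
  proof (cases "u = Suc h")
    case True
    then show ?thesis using us u by (auto simp: box_lists_def)
  next
    case False
    then have "u \<le> h" using us u by (auto simp: box_lists_def)
    then have "us \<in> box_lists (Suc s) lo h" using us u by (fastforce simp: box_lists_def)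
    then show ?thesis by simp
  qed
next
  fix us assume "us \<in> box_lists (Suc s) lo h \<union> (#) (Suc h) ` box_lists s lo (Suc h)"
  then show "us \<in> box_lists (Suc s) lo (Suc h)"
    using assms by (fastforce simp: box_lists_def)
qed

text \<open>
  This is the Gaussian binomial coefficient, by its Pascal recursion: the largest entry is at most \<open>lo + L\<close>,
  or it equals \<open>lo + L + 1\<close> and may be removed.
\<close>
lemma (in not_root_of_unity) sum_box_lists_add:
  "(\<Sum>us\<in>box_lists s lo (lo + L). q ^ sum_list us) =
     q ^ (s * lo) * qpoch q (L + s) * rq (int L) * rq (int s)"
proof (induction L arbitrary: s)
  case 0
  show ?case
    using qpoch_nonzero by (simp add: box_lists_singleton rqpoch_def sum_list_replicate)
next
  case (Suc L)
  note IH_L = Suc.IH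
  show ?case
  proof (induction s)
    case 0
    show ?case
      unfolding rqpoch_of_nat using qpoch_nonzero[of "Suc L"] by (simp add: box_lists_0)
  next
    case (Suc s)
    have disj: "box_lists (Suc s) lo (lo + L) \<inter> (#) (Suc (lo + L)) ` box_lists s lo (Suc (lo + L)) = {}"
      by (auto simp: box_lists_def)
    have "(\<Sum>us\<in>box_lists (Suc s) lo (lo + Suc L). q ^ sum_list us) =
        (\<Sum>us\<in>box_lists (Suc s) lo (lo + L). q ^ sum_list us) +
        (\<Sum>us\<in>(#) (Suc (lo + L)) ` box_lists s lo (lo + Suc L). q ^ sum_list us)"
      unfolding add_Suc_right box_lists_Suc[OF le_add1]
      by (rule sum.union_disjoint) (use disj in auto)
    also have "(\<Sum>us\<in>(#) (Suc (lo + L)) ` box_lists s lo (lo + Suc L). q ^ sum_list us) =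
        q ^ (Suc (lo + L)) * (\<Sum>us\<in>box_lists s lo (lo + Suc L). q ^ sum_list us)"
      unfolding sum_distrib_left
      by (subst sum.reindex) (auto simp: power_add mult_ac)
    also have "(\<Sum>us\<in>box_lists s lo (lo + Suc L). q ^ sum_list us) =
        q ^ (s * lo) * qpoch q (Suc L + s) * rq (int (Suc L)) * rq (int s)"
      by (rule Suc.IH)
    also have "(\<Sum>us\<in>box_lists (Suc s) lo (lo + L). q ^ sum_list us) =
        q ^ (Suc s * lo) * qpoch q (L + Suc s) * rq (int L) * rq (int (Suc s))"
      by (rule IH_L)
    also have "rq (int L) = (1 - q ^ Suc L) * rq (int (Suc L))"
      using rq_pred[of "int (Suc L)"] unfolding power_int_of_nat by simp
    also have "rq (int s) = (1 - q ^ Suc s) * rq (int (Suc s))"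
      using rq_pred[of "int (Suc s)"] unfolding power_int_of_nat by simp
    also have "qpoch q (Suc L + s) = qpoch q (L + Suc s)" by simp
    finally show ?case
      by (simp add: qpoch_Suc power_add algebra_simps)
  qed
qed

lemma (in not_root_of_unity) sum_box_lists:
  assumes "s \<le> N"
  shows "(\<Sum>us\<in>box_lists s s N. q ^ sum_list us) =
     q ^ (s * s) * qpoch q N * rq (int N - int s) * rq (int s)"
  using sum_box_lists_add[of s s "N - s"] assms by (simp add: of_nat_diff)

section \<open>Recursive form of the dissection\<close>

text \<open>
  \<open>dissected N es ns xs\<close> peels off the first rectangle: the \<open>m\<close> rows \<open>us\<close> reach at least to column \<open>m\<close> and at most to
  column \<open>N\<close>, an extra row (\<open>e = 1\<close>) is exactly \<open>m\<close> long, and the parts below are at most \<open>m\<close>. The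
  last point, expressed by the bound in the recursive call, makes the rectangle the largest one.
  The list \<open>es\<close> has the numbers of extra rows of all rectangles that are permitted; \<open>ns\<close> may be shorter.
\<close>
fun dissected :: "nat \<Rightarrow> nat list \<Rightarrow> nat list \<Rightarrow> nat list \<Rightarrow> bool" where
  "dissected N es [] xs \<longleftrightarrow> xs = []"
| "dissected N [] (m # ns) xs \<longleftrightarrow> False"
| "dissected N (e # es) (m # ns) xs \<longleftrightarrow> 0 < m \<and>
     (\<exists>us zs. xs = us @ replicate e m @ zs \<and> us \<in> box_lists m m N \<and> dissected m es ns zs)"

lemma dissected_partition:
  "dissected N es ns xs \<Longrightarrow> sorted_wrt (\<ge>) xs \<and> set xs \<subseteq> {1..N}"
proof (induction N es ns xs rule: dissected.induct)
  case (3 N e es m ns xs)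
  then obtain us zs where xs: "0 < m" "xs = us @ replicate e m @ zs" "us \<in> box_lists m m N"
    "dissected m es ns zs" by auto
  then have zs: "sorted_wrt (\<ge>) zs" "set zs \<subseteq> {1..m}"
    using "3.IH" by auto
  have us: "sorted_wrt (\<ge>) us" "set us \<subseteq> {m..N}" "us \<noteq> []"
    using xs by (auto simp: box_lists_def)
  then have mN: "m \<le> N" by (cases us) auto
  have rep: "sorted_wrt (\<ge>) (replicate e m)"
    by (induction e) auto
  have "y \<le> x" if "x \<in> set us" "y \<in> set zs" for x y
  proof -
    have "y \<le> m" "m \<le> x" using that us(2) zs(2) by auto
    then show ?thesis by simp
  qed
  then have "sorted_wrt (\<ge>) xs"
    using zs us rep unfolding xs(2) by (auto simp: sorted_wrt_append)
  moreover have "set xs \<subseteq> {1..N}"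
    using zs us mN xs(1) unfolding xs(2) by fastforce
  ultimately show ?case ..
qed auto

lemma nth_append_mem:
  assumes "length us = m" "m < length (us @ ys)"
  shows "(us @ ys) ! m \<in> set ys"
  using assms nth_mem[of 0 ys] by (simp add: nth_append)

text \<open>
  If \<open>m < m'\<close>, the entry with index \<open>m\<close> is at most \<open>m\<close> by the first decomposition and at least \<open>m'\<close> by the second.
\<close>
lemma first_width_unique:
  assumes eq: "us @ replicate e m @ zs = us' @ replicate e m' @ zs'"
    and "us \<in> box_lists m m N" "us' \<in> box_lists m' m' N'"
    and "set zs \<subseteq> {1..m}" "set zs' \<subseteq> {1..m'}"
  shows "m = m' \<and> us = us' \<and> zs = zs'"
proof -
  have le: "m' \<le> m"
    if eq: "us @ replicate e m @ zs = us' @ replicate e m' @ zs'"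
      and us: "length us = m" and us': "length us' = m'" "set us' \<subseteq> {m'..N'}"
      and zs: "set zs \<subseteq> {1..m}" for m m' us us' zs zs' N'
  proof (rule ccontr)
    assume "\<not> m' \<le> m"
    then have "m < m'" by simp
    then have "(us' @ replicate e m' @ zs') ! m = us' ! m"
      using us' by (simp add: nth_append)
    moreover have "us' ! m \<ge> m'"
      using us' \<open>m < m'\<close> nth_mem[of m us'] by (auto simp: subset_iff)
    moreover have "length (us @ replicate e m @ zs) > m"
      unfolding eq using us' \<open>m < m'\<close> by simp
    then have "(us @ replicate e m @ zs) ! m \<in> set (replicate e m @ zs)"
      using us by (intro nth_append_mem)
    then have "(us @ replicate e m @ zs) ! m \<le> m"
      using zs by (auto split: if_splits)
    ultimately show False using eq \<open>m < m'\<close> by simp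
  qed
  have "m = m'"
    using assms le[of us m zs us' m' zs' N'] le[of us' m' zs' us m zs N]
    by (auto simp: box_lists_def)
  then show ?thesis
    using assms by (auto simp: box_lists_def)
qed

lemma dissected_unique:
  "dissected N es ns xs \<Longrightarrow> dissected N' es ns' xs \<Longrightarrow> ns = ns'"
proof (induction N es ns xs arbitrary: N' ns' rule: dissected.induct)
  case (1 N es xs)
  then show ?case by (cases ns'; cases es) (auto simp: box_lists_def)
next
  case (3 N e es m ns xs)
  from "3.prems"(1) obtain us zs where xs: "0 < m" "xs = us @ replicate e m @ zs"
    "us \<in> box_lists m m N" "dissected m es ns zs" by auto
  then have "xs \<noteq> []" by (auto simp: box_lists_def)
  with "3.prems"(2) obtain m' ms us' zs' where ys: "ns' = m' # ms" "0 < m'"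
    "xs = us' @ replicate e m' @ zs'" "us' \<in> box_lists m' m' N'" "dissected m' es ms zs'"
    by (cases ns') auto
  have "m = m' \<and> us = us' \<and> zs = zs'"
    using first_width_unique[of us e m zs us' m' zs' N N'] xs ys dissected_partition by metis
  then show ?case using "3.IH" xs ys by blast
qed auto

definition dissected_lists :: "nat \<Rightarrow> nat list \<Rightarrow> nat list set" where
  "dissected_lists N es = {xs. \<exists>ns. dissected N es ns xs}"

lemma dissected_lists_Nil: "dissected_lists N [] = {[]}"
proof -
  have "dissected N [] ns xs \<longleftrightarrow> ns = [] \<and> xs = []" for ns xs
    by (cases ns) auto
  then show ?thesis by (auto simp: dissected_lists_def)
qed

lemma dissected_lists_Cons:
  "dissected_lists N (e # es) = insert [] (\<Union>m\<in>{1..N}.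
     (\<lambda>(us, zs). us @ replicate e m @ zs) ` (box_lists m m N \<times> dissected_lists m es))"
proof (intro equalityI subsetI)
  fix xs assume "xs \<in> dissected_lists N (e # es)"
  then obtain ns where ns: "dissected N (e # es) ns xs" by (auto simp: dissected_lists_def)
  show "xs \<in> insert [] (\<Union>m\<in>{1..N}.
     (\<lambda>(us, zs). us @ replicate e m @ zs) ` (box_lists m m N \<times> dissected_lists m es))"
  proof (cases ns)
    case Nil
    then show ?thesis using ns by simp
  next
    case (Cons m ms)
    then obtain us zs where xs: "0 < m" "xs = us @ replicate e m @ zs"
      "us \<in> box_lists m m N" "dissected m es ms zs" using ns by auto
    have "m \<le> N" using xs(1,3) by (cases us) (auto simp: box_lists_def)
    then have "m \<in> {1..N}" using xs(1) by simp
    moreover have "xs \<in> (\<lambda>(us, zs). us @ replicate e m @ zs) `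
        (box_lists m m N \<times> dissected_lists m es)"
      using xs by (auto simp: dissected_lists_def)
    ultimately show ?thesis by blast
  qed
next
  fix xs assume "xs \<in> insert [] (\<Union>m\<in>{1..N}.
     (\<lambda>(us, zs). us @ replicate e m @ zs) ` (box_lists m m N \<times> dissected_lists m es))"
  then consider "xs = []" | m us zs ms where "m \<in> {1..N}" "xs = us @ replicate e m @ zs"
    "us \<in> box_lists m m N" "dissected m es ms zs"
    by (auto simp: dissected_lists_def)
  then show "xs \<in> dissected_lists N (e # es)"
  proof cases
    case 1
    have "dissected N (e # es) [] []" by simp
    then show ?thesis unfolding dissected_lists_def 1 by blast
  next
    case 2
    then have "dissected N (e # es) (m # ms) xs" by auto
    then show ?thesis unfolding dissected_lists_def by blast
  qed
qed

lemma finite_dissected_lists [simp]: "finite (dissected_lists N es)"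
  by (induction es arbitrary: N) (simp_all add: dissected_lists_Nil dissected_lists_Cons)

lemma dissected_lists_0: "dissected_lists 0 es = {[]}"
  by (cases es) (simp_all add: dissected_lists_Nil dissected_lists_Cons)

text \<open>
  A rectangle of width \<open>m\<close> contributes \<open>q\<^bsup>m(m+e)\<^esup>\<close>, and the parts of its \<open>m\<close> free rows beyond column \<open>m\<close> form a
  partition in an \<open>m \<times> (N - m)\<close> box. The term \<open>m = 0\<close> of the multiple sum accounts for the empty partition.
\<close>
theorem (in not_root_of_unity) sum_dissected_lists:
  "(\<Sum>xs\<in>dissected_lists N es. q ^ sum_list xs) = qpoch q N * chain_sum es N"
proof (induction es arbitrary: N)
  case Nil
  show ?case using qpoch_nonzero by (simp add: dissected_lists_Nil rqpoch_def)
next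
  case (Cons e es)
  let ?glue = "\<lambda>m (us, zs). us @ replicate e m @ zs"
  let ?D = "\<lambda>m. box_lists m m N \<times> dissected_lists m es"
  have bound: "set zs \<subseteq> {1..m}" if "zs \<in> dissected_lists m es" for zs m
    using that unfolding dissected_lists_def by (blast dest: dissected_partition)
  have inj: "m = m' \<and> us = us' \<and> zs = zs'"
    if "?glue m (us, zs) = ?glue m' (us', zs')" "(us, zs) \<in> ?D m" "(us', zs') \<in> ?D m'"
    for m m' us us' zs zs'
    using that first_width_unique[of us e m zs us' m' zs' N N] bound by auto
  have nonempty: "[] \<notin> ?glue m ` ?D m" if "m \<in> {1..N}" for m
    using that by (auto simp: box_lists_def)
  let ?f = "\<lambda>s. qpoch q N * (q ^ (s * (s + e)) * rq (int N - int s) * chain_sum es s)"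
  have block: "(\<Sum>xs\<in>?glue m ` ?D m. q ^ sum_list xs) = ?f m"
    if "m \<in> {1..N}" for m
  proof -
    have "inj_on (?glue m) (?D m)"
    proof (rule inj_onI)
      fix p p' assume "p \<in> ?D m" "p' \<in> ?D m" "?glue m p = ?glue m p'"
      then show "p = p'"
        using inj[of m "fst p" "snd p" m "fst p'" "snd p'"] by (simp add: prod_eq_iff case_prod_unfold)
    qed
    then have "(\<Sum>xs\<in>?glue m ` ?D m. q ^ sum_list xs) =
        (\<Sum>(us, zs)\<in>?D m. q ^ sum_list us * (q ^ (e * m) * q ^ sum_list zs))"
      by (subst sum.reindex) (auto simp: power_add sum_list_replicate intro!: sum.cong)
    also have "\<dots> = (\<Sum>us\<in>box_lists m m N. q ^ sum_list us) *
        (\<Sum>zs\<in>dissected_lists m es. q ^ (e * m) * q ^ sum_list zs)"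
      by (simp only: sum_product sum.cartesian_product)
    also have "\<dots> = q ^ (e * m) * ((\<Sum>us\<in>box_lists m m N. q ^ sum_list us) *
        (\<Sum>zs\<in>dissected_lists m es. q ^ sum_list zs))"
      unfolding sum_distrib_left[symmetric] by (simp only: mult_ac)
    also have "\<dots> = q ^ (e * m) * (q ^ (m * m) * qpoch q N * rq (int N - int m) * rq (int m) *
        (qpoch q m * chain_sum es m))"
      using that by (simp add: sum_box_lists Cons.IH)
    also have "rq (int m) = inverse (qpoch q m)"
      by (simp add: rqpoch_def)
    finally show ?thesis
      using qpoch_nonzero[of m] by (simp add: power_add algebra_simps)
  qed
  let ?A = "\<Union>m\<in>{1..N}. ?glue m ` ?D m"
  have "[] \<notin> ?A" using nonempty by blast
  moreover have "finite ?A" by simp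
  ultimately have "(\<Sum>xs\<in>dissected_lists N (e # es). q ^ sum_list xs) =
      1 + (\<Sum>xs\<in>?A. q ^ sum_list xs)"
    unfolding dissected_lists_Cons by (subst sum.insert) (simp_all only: sum_list.Nil power_0 not_False_eq_True)
  also have "(\<Sum>xs\<in>(\<Union>m\<in>{1..N}. ?glue m ` ?D m). q ^ sum_list xs) =
      (\<Sum>m\<in>{1..N}. \<Sum>xs\<in>?glue m ` ?D m. q ^ sum_list xs)"
  proof (rule sum.UNION_disjoint)
    show "\<forall>m\<in>{1..N}. \<forall>m'\<in>{1..N}. m \<noteq> m' \<longrightarrow> ?glue m ` ?D m \<inter> ?glue m' ` ?D m' = {}"
    proof (intro ballI impI)
      fix m m' :: nat assume "m \<noteq> m'"
      have "?glue m p \<noteq> ?glue m' p'" if "p \<in> ?D m" "p' \<in> ?D m'" for p p'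
      proof
        assume "?glue m p = ?glue m' p'"
        then have "m = m'"
          using that inj[of m "fst p" "snd p" m' "fst p'" "snd p'"] by (simp add: case_prod_unfold)
        with \<open>m \<noteq> m'\<close> show False ..
      qed
      then show "?glue m ` ?D m \<inter> ?glue m' ` ?D m' = {}" by blast
    qed
  qed auto
  also have "\<dots> = (\<Sum>m\<in>{1..N}. ?f m)"
    by (rule sum.cong) (use block in auto)
  also have "1 = ?f 0"
    using Cons.IH[of 0] qpoch_nonzero[of N] by (simp add: dissected_lists_0 rqpoch_def)
  also have "?f 0 + (\<Sum>m\<in>{1..N}. ?f m) = (\<Sum>m\<le>N. ?f m)"
  proof -
    have "{..N} = insert 0 {1..N}" by auto
    then show ?thesis by (simp only:) (subst sum.insert; simp)
  qed
  also have "\<dots> = qpoch q N * chain_sum (e # es) N"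
    by (simp add: sum_distrib_left)
  finally show ?case .
qed

section \<open>Admissibility in recursive form\<close>

lemma rect_fits_iff:
  "0 < w \<Longrightarrow> rect_fits h w xs \<longleftrightarrow> (\<forall>i<h. i < length xs \<and> w \<le> xs ! i)"
  unfolding rect_fits_def ferrers_def
  by (auto simp: subset_iff not_less[symmetric])

text \<open>
  In a weakly decreasing list, the rectangle of width \<open>m\<close> is the largest one if and only if it fits and the next row below
  it is at most \<open>m\<close> long. For \<open>e = 1\<close> already the last row, being of length \<open>m\<close>, rules out wider rectangles.
\<close>
lemma first_rectangle_iff:
  assumes xs: "sorted_wrt (\<ge>) xs" "set xs \<subseteq> {1..N}" and m: "0 < m" and e: "e \<in> {0, 1}"
  shows "largest_rect e m xs \<and> (e = 1 \<longrightarrow> xs ! (m + e - 1) = m) \<longleftrightarrow>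
    (\<exists>us zs. xs = us @ replicate e m @ zs \<and> us \<in> box_lists m m N \<and> set zs \<subseteq> {1..m})"
    (is "?L \<longleftrightarrow> ?R")
proof
  assume L: ?L
  let ?us = "take m xs" and ?zs = "drop (m + e) xs"
  have fits: "i < length xs" "m \<le> xs ! i" if "i < m + e" for i
    using L that m by (auto simp: largest_rect_def rect_fits_iff)
  have len: "m + e \<le> length xs"
    using fits(1)[of "m + e - 1"] m by simp
  have mid: "drop m xs = replicate e m @ ?zs"
  proof (cases "e = 0")
    case False
    then have "e = 1" using e by simp
    then show ?thesis using L len by (simp add: Cons_nth_drop_Suc[symmetric])
  qed simp
  have below: "xs ! i \<le> m" if "m + e \<le> i" "i < length xs" for i
  proof (rule ccontr)
    assume "\<not> xs ! i \<le> m"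
    then have above: "Suc m \<le> xs ! l" if "l \<le> i" for l
      using that \<open>i < length xs\<close> xs(1)
      using sorted_wrt_nth_less[OF xs(1), of l i] by (cases "l = i") auto
    then have "rect_fits (Suc m + e) (Suc m) xs"
      using that above by (auto simp: rect_fits_iff)
    then have "Suc m \<le> m" using L unfolding largest_rect_def by blast
    then show False by simp
  qed
  have "set ?zs \<subseteq> {1..m}"
  proof
    fix x assume "x \<in> set ?zs"
    then obtain i where "i < length ?zs" "x = ?zs ! i" by (auto simp: in_set_conv_nth)
    then have "x \<le> m" using below[of "m + e + i"] len by simp
    moreover have "x \<in> set xs" using \<open>x \<in> set ?zs\<close> by (rule in_set_dropD)
    ultimately show "x \<in> {1..m}" using xs(2) by auto
  qed
  moreover have "x \<in> {m..N}" if x: "x \<in> set ?us" for x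
  proof -
    obtain i where "i < length ?us" "x = ?us ! i" using x unfolding in_set_conv_nth by blast
    then have "m \<le> x" using len fits[of i] by auto
    moreover have "x \<le> N" using in_set_takeD[OF x] xs(2) by auto
    ultimately show ?thesis by simp
  qed
  then have "?us \<in> box_lists m m N"
    using len xs by (auto simp: box_lists_def sorted_wrt_take)
  moreover have "xs = ?us @ replicate e m @ ?zs"
    unfolding mid[symmetric] by simp
  ultimately show ?R by blast
next
  assume ?R
  then obtain us zs where eq: "xs = us @ replicate e m @ zs"
    and us: "us \<in> box_lists m m N" and zs: "set zs \<subseteq> {1..m}" by blast
  have len: "length us = m" using us by (simp add: box_lists_def)
  have "m \<le> x" if "x \<in> set (us @ replicate e m)" for x
    using that us by (auto simp: box_lists_def split: if_splits)
  then have "m \<le> xs ! i" if "i < m + e" for i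
  proof -
    have "xs ! i = (us @ replicate e m) ! i"
      using that len unfolding eq append_assoc[symmetric] by (subst nth_append) auto
    then show ?thesis using that len \<open>\<And>x. x \<in> set (us @ replicate e m) \<Longrightarrow> m \<le> x\<close>
      by (metis length_append length_replicate nth_mem)
  qed
  then have "rect_fits (m + e) m xs"
    using m len by (auto simp: rect_fits_iff eq)
  moreover have "m' \<le> m" if "rect_fits (m' + e) m' xs" for m'
  proof (rule ccontr)
    assume "\<not> m' \<le> m"
    then have *: "m < length xs" "m' \<le> xs ! m"
      using that by (auto simp: rect_fits_iff)
    then have "xs ! m \<in> set (replicate e m @ zs)"
      using len unfolding eq by (intro nth_append_mem)
    then have "xs ! m \<le> m" using zs by (auto split: if_splits)
    then show False using * \<open>\<not> m' \<le> m\<close> by simp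
  qed
  moreover have "e = 1 \<longrightarrow> xs ! (m + e - 1) = m"
    using len by (simp add: eq nth_append)
  ultimately show ?L by (simp add: largest_rect_def)
qed

definition rows_before :: "nat list \<Rightarrow> nat list \<Rightarrow> nat \<Rightarrow> nat" where
  "rows_before es ns i = (\<Sum>l<i. ns ! l + es ! l)"

lemma rows_before_0 [simp]: "rows_before es ns 0 = 0"
  by (simp add: rows_before_def)

lemma rows_before_Cons: "rows_before (e # es) (m # ns) (Suc i) = m + e + rows_before es ns i"
  unfolding rows_before_def sum.lessThan_Suc_shift by simp

lemma dissected_iff:
  assumes "sorted_wrt (\<ge>) xs" "set xs \<subseteq> {1..N}" "set es \<subseteq> {0, 1}"
  shows "dissected N es ns xs \<longleftrightarrow> length ns \<le> length es \<and>
    (\<forall>i<length ns. 1 \<le> ns ! i \<and> largest_rect (es ! i) (ns ! i) (drop (rows_before es ns i) xs) \<and>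
       (es ! i = 1 \<longrightarrow> xs ! (rows_before es ns (Suc i) - 1) = ns ! i)) \<and>
    rows_before es ns (length ns) = length xs"
  using assms
proof (induction N es ns xs rule: dissected.induct)
  case (3 N e es m ns xs)
  note xs = "3.prems"(1,2)
  have e: "e \<in> {0, 1}" and es: "set es \<subseteq> {0, 1}" using "3.prems"(3) by auto
  let ?zs = "drop (m + e) xs"
  define tail where "tail \<longleftrightarrow> length ns \<le> length es \<and>
    (\<forall>i<length ns. 1 \<le> ns ! i \<and> largest_rect (es ! i) (ns ! i) (drop (rows_before es ns i) ?zs) \<and>
       (es ! i = 1 \<longrightarrow> ?zs ! (rows_before es ns (Suc i) - 1) = ns ! i)) \<and>
    rows_before es ns (length ns) = length ?zs"
  have IH: "dissected m es ns ?zs \<longleftrightarrow> tail" if "set ?zs \<subseteq> {1..m}"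
    unfolding tail_def by (rule "3.IH") (use xs that es in \<open>auto simp: sorted_wrt_drop\<close>)
  have "dissected N (e # es) (m # ns) xs \<longleftrightarrow> 0 < m \<and>
     (\<exists>us zs. xs = us @ replicate e m @ zs \<and> us \<in> box_lists m m N \<and> set zs \<subseteq> {1..m}) \<and>
     dissected m es ns ?zs"
  proof -
    have "zs = ?zs" if "xs = us @ replicate e m @ zs" "us \<in> box_lists m m N" for us zs
      using that by (simp add: box_lists_def)
    then show ?thesis using dissected_partition by fastforce
  qed
  also have "\<dots> \<longleftrightarrow> 0 < m \<and>
     (\<exists>us zs. xs = us @ replicate e m @ zs \<and> us \<in> box_lists m m N \<and> set zs \<subseteq> {1..m}) \<and> tail"
  proof -
    have "set ?zs \<subseteq> {1..m}"
      if "xs = us @ replicate e m @ zs" "us \<in> box_lists m m N" "set zs \<subseteq> {1..m}" for us zs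
      using that by (simp add: box_lists_def)
    then show ?thesis using IH by blast
  qed
  also have "\<dots> \<longleftrightarrow> 0 < m \<and> largest_rect e m xs \<and> (e = 1 \<longrightarrow> xs ! (m + e - 1) = m) \<and> tail"
    using first_rectangle_iff[OF xs _ e, of m] by blast
  also have "\<dots> \<longleftrightarrow> length (m # ns) \<le> length (e # es) \<and>
    (\<forall>i<length (m # ns). 1 \<le> (m # ns) ! i \<and>
       largest_rect ((e # es) ! i) ((m # ns) ! i) (drop (rows_before (e # es) (m # ns) i) xs) \<and>
       ((e # es) ! i = 1 \<longrightarrow> xs ! (rows_before (e # es) (m # ns) (Suc i) - 1) = (m # ns) ! i)) \<and>
    rows_before (e # es) (m # ns) (length (m # ns)) = length xs" (is "_ \<longleftrightarrow> ?goal")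
  proof (cases "0 < m \<and> m + e \<le> length xs")
    case True
    have idx: "xs ! (m + e + rows_before es ns (Suc i) - 1) = ?zs ! (rows_before es ns (Suc i) - 1)"
      if "1 \<le> ns ! i" for i
    proof -
      have "0 < rows_before es ns (Suc i)" using that by (simp add: rows_before_def)
      then show ?thesis using True by simp
    qed
    have "tail \<longleftrightarrow> length ns \<le> length es \<and>
      (\<forall>i<length ns. 1 \<le> ns ! i \<and>
         largest_rect (es ! i) (ns ! i) (drop (m + e + rows_before es ns i) xs) \<and>
         (es ! i = 1 \<longrightarrow> xs ! (m + e + rows_before es ns (Suc i) - 1) = ns ! i)) \<and>
      m + e + rows_before es ns (length ns) = length xs"
    proof -
      have "(\<forall>i<length ns. 1 \<le> ns ! i \<and>
          largest_rect (es ! i) (ns ! i) (drop (m + e + rows_before es ns i) xs) \<and>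
          (es ! i = 1 \<longrightarrow> ?zs ! (rows_before es ns (Suc i) - 1) = ns ! i)) \<longleftrightarrow>
        (\<forall>i<length ns. 1 \<le> ns ! i \<and>
          largest_rect (es ! i) (ns ! i) (drop (m + e + rows_before es ns i) xs) \<and>
          (es ! i = 1 \<longrightarrow> xs ! (m + e + rows_before es ns (Suc i) - 1) = ns ! i))"
        by (intro all_cong1 imp_cong conj_cong refl) (simp only: idx)
      moreover have "rows_before es ns (length ns) = length ?zs \<longleftrightarrow>
          m + e + rows_before es ns (length ns) = length xs"
        using True by auto
      moreover have "drop (rows_before es ns i) ?zs = drop (m + e + rows_before es ns i) xs" for i
        by (simp add: add.commute)
      ultimately show ?thesis
        unfolding tail_def by (simp only:)
    qed
    then show ?thesis
      unfolding length_Cons All_less_Suc2 rows_before_Cons nth_Cons_Suc nth_Cons_0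
        rows_before_0 drop_0 Suc_le_mono
      using True by (simp only: Suc_le_eq One_nat_def add_0_right) blast
  next
    case False
    have "m + e \<le> length xs" if "0 < m" "largest_rect e m xs"
    proof -
      have "\<forall>i<m + e. i < length xs" using that by (auto simp: largest_rect_def rect_fits_iff)
      from this[rule_format, of "m + e - 1"] show ?thesis using that by simp
    qed
    moreover have "1 \<le> m" "largest_rect e m xs" if ?goal
      using that by (auto simp: All_less_Suc2)
    ultimately show ?thesis using False by auto
  qed
  finally show ?case .
qed (auto simp: rows_before_def)

definition row_flags :: "nat \<Rightarrow> nat \<Rightarrow> nat list" where
  "row_flags k a = replicate (k - a) 0 @ replicate a 1"

lemma admissible_with_iff_dissected:
  assumes xs: "sorted_wrt (\<ge>) xs" "set xs \<subseteq> {1..N}" and a: "a \<le> k"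
  shows "admissible_with k a ns xs \<longleftrightarrow> dissected N (row_flags k a) ns xs"
proof (cases "length ns \<le> k")
  case False
  then show ?thesis using a
    by (subst dissected_iff[OF xs]) (auto simp: admissible_with_def row_flags_def)
next
  case len: True
  have flag: "row_flags k a ! i = extra_row k a i" if "i < k" for i
    using that a by (auto simp: row_flags_def extra_row_def nth_append)
  have rows: "rows_before (row_flags k a) ns i = rows_above k a ns i" if "i \<le> length ns" for i
    unfolding rows_before_def rows_above_def by (rule sum.cong) (use that len flag in auto)
  have last: "sum_list (take (k - a + i) ns) + i = rows_above k a ns (k - a + i)"
    if "k - a + i \<le> length ns" for i
  proof -
    have "(\<Sum>l<k - a + i. extra_row k a l) = i"
      by (induction i) (auto simp: extra_row_def)
    moreover have "sum_list (take (k - a + i) ns) = (\<Sum>l<k - a + i. ns ! l)"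
      using that by (simp add: sum_list_sum_nth atLeast0LessThan)
    ultimately show ?thesis
      by (simp add: rows_above_def sum.distrib)
  qed
  have "(\<forall>i\<in>{1..length ns - (k - a)}.
        xs ! (sum_list (take (k - a + i) ns) + i - 1) = ns ! (k - a + i - 1)) \<longleftrightarrow>
      (\<forall>i<length ns. row_flags k a ! i = 1 \<longrightarrow>
         xs ! (rows_before (row_flags k a) ns (Suc i) - 1) = ns ! i)" (is "?A \<longleftrightarrow> ?B")
  proof
    assume A: ?A
    show ?B
    proof (intro allI impI)
      fix i assume i: "i < length ns" and "row_flags k a ! i = 1"
      then have "extra_row k a i = 1" using flag[of i] len by simp
      then have "k - a \<le> i" unfolding extra_row_def by (meson linorder_not_le zero_neq_one)
      define d where "d = Suc i - (k - a)"
      then have d: "k - a + d = Suc i" "d \<in> {1..length ns - (k - a)}"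
        using i \<open>k - a \<le> i\<close> by auto
      have "xs ! (sum_list (take (k - a + d) ns) + d - 1) = ns ! (k - a + d - 1)"
        using A d(2) by (rule bspec)
      moreover have "sum_list (take (k - a + d) ns) + d = rows_above k a ns (k - a + d)"
        by (rule last) (use i d in simp)
      ultimately show "xs ! (rows_before (row_flags k a) ns (Suc i) - 1) = ns ! i"
        unfolding d(1) using rows[of "Suc i"] i by simp
    qed
  next
    assume B: ?B
    show ?A
    proof
      fix i assume i: "i \<in> {1..length ns - (k - a)}"
      let ?l = "k - a + i - 1"
      have l: "?l < length ns" "Suc ?l = k - a + i" using i by auto
      have "extra_row k a ?l = 1"
        using i by (auto simp: extra_row_def)
      then have "row_flags k a ! ?l = 1"
        using flag[of ?l] len l by simp
      then have "xs ! (rows_before (row_flags k a) ns (Suc ?l) - 1) = ns ! ?l"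
        using B l(1) by blast
      moreover have "rows_before (row_flags k a) ns (Suc ?l) = rows_above k a ns (k - a + i)"
        unfolding l(2) by (rule rows) (use l in simp)
      moreover have "\<dots> = sum_list (take (k - a + i) ns) + i"
        by (rule last[symmetric]) (use l in simp)
      ultimately show "xs ! (sum_list (take (k - a + i) ns) + i - 1) = ns ! ?l"
        by (simp only:)
    qed
  qed
  moreover have "(\<forall>i<length ns. 1 \<le> ns ! i \<and>
        largest_rect (extra_row k a i) (ns ! i) (drop (rows_above k a ns i) xs)) \<longleftrightarrow>
      (\<forall>i<length ns. 1 \<le> ns ! i \<and>
        largest_rect (row_flags k a ! i) (ns ! i) (drop (rows_before (row_flags k a) ns i) xs))"
    by (intro all_cong1 imp_cong refl) (use len flag rows in auto)
  moreover have "rows_before (row_flags k a) ns (length ns) = rows_above k a ns (length ns)"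
    by (rule rows) simp
  moreover have "set (row_flags k a) \<subseteq> {0, 1}" "length (row_flags k a) = k"
    using a by (auto simp: row_flags_def)
  ultimately show ?thesis
    unfolding admissible_with_def durfee_dissection_def
    by (subst dissected_iff[OF xs]) (simp_all only:, blast)
qed

section \<open>Transfer to formal power series\<close>

lemma not_root_of_unity_fls_X:
  assumes "0 < m"
  shows "not_root_of_unity (fls_X ^ m :: rat fls)"
proof
  show "(fls_X ^ m :: rat fls) \<noteq> 0" by simp
next
  fix n :: nat assume "0 < n"
  then have "fls_subdegree ((fls_X ^ m) ^ n :: rat fls) \<noteq> fls_subdegree (1 :: rat fls)"
    using assms by (simp add: power_mult[symmetric] fls_subdegree_pow)
  then show "(fls_X ^ m :: rat fls) ^ n \<noteq> 1" by metis
qed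

lemma fps_to_fls_sum: "fps_to_fls (sum f A) = (\<Sum>x\<in>A. fps_to_fls (f x))"
  by (induction A rule: infinite_finite_induct) (simp_all)

lemma fps_to_fls_prod:
  "fps_to_fls (prod f A) = (\<Prod>x\<in>A. fps_to_fls (f x :: 'a::comm_ring_1 fps))"
  by (induction A rule: infinite_finite_induct) (simp_all add: fls_times_fps_to_fls)

lemma fps_to_fls_qpoch: "fps_to_fls (qpoch (fps_X ^ m :: rat fps) n) = qpoch (fls_X ^ m) n"
  by (induction n) (simp_all add: qpoch_Suc fls_times_fps_to_fls fps_to_fls_power)

lemma qpoch_fps_nth_0: "0 < m \<Longrightarrow> qpoch (fps_X ^ m :: rat fps) n $ 0 = 1"
  by (induction n) (simp_all add: qpoch_Suc)

text \<open>
  The power series form of \<open>bailey_sum\<close> with base \<open>q\<^sup>m\<close> and coefficients \<open>(-1)\<^sup>j q\<^bsup>E j\<^esup>\<close>; the same exponents \<open>E\<close> will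
  occur with \<open>m = 1\<close> and with \<open>m = 2 k + 3\<close>.
\<close>
definition theta_quotient :: "nat \<Rightarrow> (int \<Rightarrow> int) \<Rightarrow> nat \<Rightarrow> rat fps" where
  "theta_quotient m E N = (\<Sum>j\<in>{- int N..int N}. (- 1) ^ nat \<bar>j\<bar> * fps_X ^ nat (E j) *
     (inverse (qpoch (fps_X ^ m) (nat (int N - j))) * inverse (qpoch (fps_X ^ m) (nat (int N + j)))))"

lemma fps_to_fls_theta_quotient:
  assumes "0 < m" and "\<And>j. 0 \<le> E j"
  shows "fps_to_fls (theta_quotient m E N) =
    not_root_of_unity.bailey_sum (fls_X ^ m) 0 (\<lambda>j. (- 1) powi j * fls_X powi E j) N"
proof -
  interpret not_root_of_unity "fls_X ^ m :: rat fls"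
    using assms(1) by (rule not_root_of_unity_fls_X)
  have inv: "fps_to_fls (inverse (qpoch (fps_X ^ m :: rat fps) n)) = inverse (qpoch (fls_X ^ m) n)" for n
  proof -
    have "subdegree (qpoch (fps_X ^ m :: rat fps) n) = 0"
      using qpoch_fps_nth_0[OF assms(1), of n] by (intro subdegree_eq_0) simp
    then show ?thesis
      by (simp add: fls_inverse_fps_to_fls[symmetric] fps_to_fls_qpoch)
  qed
  have sgn: "fps_to_fls ((- 1) ^ nat \<bar>j\<bar> :: rat fps) = (- 1) powi j" for j
  proof -
    have "(- 1 :: rat fls) ^ nat \<bar>j\<bar> = (- 1) powi j"
      by (cases "0 \<le> j") (auto simp: power_int_def)
    then show ?thesis by (simp add: fps_to_fls_power)
  qed
  have pow: "fps_to_fls (fps_X ^ nat (E j) :: rat fps) = fls_X powi E j" for j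
    using assms(2)[of j] by (simp add: fps_to_fls_power power_int_def)
  show ?thesis
    unfolding theta_quotient_def bailey_sum_def fps_to_fls_sum add_0_right
  proof (rule sum.cong)
    fix j assume "j \<in> {- int N..int N}"
    then have "\<not> int N - j < 0" "\<not> int N + j < 0" by auto
    then show "fps_to_fls ((- 1) ^ nat \<bar>j\<bar> * fps_X ^ nat (E j) *
       (inverse (qpoch (fps_X ^ m) (nat (int N - j))) * inverse (qpoch (fps_X ^ m) (nat (int N + j))))) =
       (- 1) powi j * fls_X powi E j * rq (int N - j) * rq (int N + j)"
      by (simp only: fls_times_fps_to_fls inv sgn pow rqpoch_def if_False mult.assoc)
  qed simp
qed

definition gordon_exponent :: "nat \<Rightarrow> nat \<Rightarrow> int \<Rightarrow> int" where
  "gordon_exponent k a j = int (k + 1) * (j * j) + int (a + 1) * j + tri j"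

lemma gordon_exponent_lower:
  assumes "a \<le> k"
  shows "\<bar>j\<bar> - 1 \<le> gordon_exponent k a j" and "0 \<le> gordon_exponent k a j"
proof -
  have "int (a + 1) * \<bar>j\<bar> \<le> int (k + 1) * (j * j)"
  proof (rule mult_mono)
    show "\<bar>j\<bar> \<le> j * j"
      by (metis abs_mult_self_eq abs_ge_zero le_less mult_le_cancel_left1 not_less int_one_le_iff_zero_less)
  qed (use assms in auto)
  moreover have "- (int (a + 1) * \<bar>j\<bar>) \<le> int (a + 1) * j"
    unfolding mult_minus_right[symmetric] by (rule mult_left_mono) auto
  ultimately have *: "tri j \<le> gordon_exponent k a j"
    by (simp add: gordon_exponent_def)
  have "2 * (\<bar>j\<bar> - 1) \<le> j * (j - 1)"
  proof (cases "1 \<le> j")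
    case True
    then have "0 \<le> (j - 1) * (j - 2)" by (cases "j = 1") auto
    then show ?thesis using True by (simp add: algebra_simps)
  next
    case False
    then have "0 \<le> j * (j + 1)" by (cases "j = 0") (auto intro: mult_nonpos_nonpos)
    then show ?thesis using False by (simp add: algebra_simps)
  qed
  moreover have "0 \<le> j * (j - 1)"
    by (cases "j \<ge> 1") (auto intro: mult_nonpos_nonpos)
  ultimately have "\<bar>j\<bar> - 1 \<le> tri j" "0 \<le> tri j"
    unfolding two_tri[symmetric] by simp_all
  then show "\<bar>j\<bar> - 1 \<le> gordon_exponent k a j" "0 \<le> gordon_exponent k a j"
    using * by simp_all
qed

lemma dissected_lists_theta:
  assumes "a \<le> k"
  shows "(\<Sum>xs\<in>dissected_lists N (row_flags k a). fps_X ^ sum_list xs) =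
    qpoch fps_X N * theta_quotient 1 (gordon_exponent k a) N"
proof -
  interpret not_root_of_unity "fls_X :: rat fls"
    using not_root_of_unity_fls_X[of 1] by simp
  have coeff: "gordon_coeff (Suc k) (Suc a) =
      (\<lambda>j. (- 1) powi j * fls_X powi gordon_exponent k a j)"
    by (simp add: gordon_coeff_def gordon_exponent_def fun_eq_iff)
  have "fps_to_fls (\<Sum>xs\<in>dissected_lists N (row_flags k a). fps_X ^ sum_list xs :: rat fps) =
      (\<Sum>xs\<in>dissected_lists N (row_flags k a). fls_X ^ sum_list xs)"
    by (simp add: fps_to_fls_sum fps_to_fls_power)
  also have "\<dots> = qpoch fls_X N * bailey_sum 0 (gordon_coeff (Suc k) (Suc a)) N"
    using assms unfolding sum_dissected_lists row_flags_def chain_sum_gordon by simp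
  also have "\<dots> = fps_to_fls (qpoch fps_X N * theta_quotient 1 (gordon_exponent k a) N)"
    using fps_to_fls_theta_quotient[of 1 "gordon_exponent k a" N] gordon_exponent_lower(2)[OF assms]
      fps_to_fls_qpoch[of 1 N]
    by (simp add: coeff fls_times_fps_to_fls)
  finally show ?thesis by (simp only: fps_to_fls_eq_iff)
qed

text \<open>
  The finite triple product in base \<open>q\<^sup>m\<close> with \<open>z = q\<^bsup>k+a+2\<^esup>\<close>, for which \<open>q\<^sup>m / z = q\<^bsup>k+1-a\<^esup>\<close>. The exponents agree with
  those of the Bailey chain as \<open>m j (j - 1) / 2 + (k + a + 2) j = (k + 1) j\<^sup>2 + (a + 1) j + j (j - 1) / 2\<close>.
\<close>
lemma residue_product_theta:
  assumes "a \<le> k"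
  defines "m \<equiv> 2 * k + 3"
  shows "(\<Prod>i=1..N. (1 - fps_X ^ (m * (i - 1) + (k + 1 - a))) * (1 - fps_X ^ (m * (i - 1) + (k + a + 2)))) =
    qpoch (fps_X ^ m) (2 * N) * theta_quotient m (gordon_exponent k a) N"
proof -
  have m: "0 < m" by (simp add: m_def)
  interpret not_root_of_unity "fls_X ^ m :: rat fls"
    using m by (rule not_root_of_unity_fls_X)
  let ?z = "fls_X ^ (k + a + 2) :: rat fls"
  have X: "(fls_X :: rat fls) \<noteq> 0" by simp
  have coeff: "(\<lambda>j. (- 1) powi j * ?z powi j * (fls_X ^ m) powi tri j) =
      (\<lambda>j. (- 1) powi j * fls_X powi gordon_exponent k a j)"
  proof
    fix j
    have "int m * tri j = int (k + 1) * (2 * tri j) + tri j"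
      by (simp add: m_def algebra_simps)
    then have "gordon_exponent k a j = int (k + a + 2) * j + int m * tri j"
      unfolding two_tri by (simp add: gordon_exponent_def algebra_simps)
    moreover have "(fls_X ^ n :: rat fls) powi i = fls_X powi (int n * i)" for n i
      by (simp only: power_int_mult power_int_of_nat)
    ultimately show "(- 1) powi j * ?z powi j * (fls_X ^ m) powi tri j =
        (- 1) powi j * fls_X powi gordon_exponent k a j"
      by (simp only: power_int_add[OF disjI1[OF X]] mult.assoc)
  qed
  have factor: "(1 - (fls_X ^ m) ^ i / ?z) * (1 - ?z * (fls_X ^ m) ^ (i - 1)) = fps_to_fls
      ((1 - fps_X ^ (m * (i - 1) + (k + 1 - a))) * (1 - fps_X ^ (m * (i - 1) + (k + a + 2))))"
    if "i \<in> {1..N}" for i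
  proof -
    have "m * i = (m * (i - 1) + (k + 1 - a)) + (k + a + 2)"
      using that assms(1) by (cases i) (auto simp: m_def)
    then have "(fls_X ^ m) ^ i / ?z = fls_X ^ (m * (i - 1) + (k + 1 - a))"
      unfolding power_mult[symmetric] by (simp only: power_add) simp
    moreover have "?z * (fls_X ^ m) ^ (i - 1) = fls_X ^ (m * (i - 1) + (k + a + 2))"
      unfolding power_mult[symmetric] power_add by simp
    ultimately show ?thesis
      by (simp only: fls_times_fps_to_fls fps_to_fls_minus fps_to_fls_power fps_one_to_fls fps_X_to_fls)
  qed
  have "fps_to_fls (\<Prod>i=1..N. (1 - fps_X ^ (m * (i - 1) + (k + 1 - a))) * (1 - fps_X ^ (m * (i - 1) + (k + a + 2)))) =
      (\<Prod>i=1..N. (1 - (fls_X ^ m) ^ i / ?z) * (1 - ?z * (fls_X ^ m) ^ (i - 1)))"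
    unfolding fps_to_fls_prod by (rule prod.cong) (simp_all only: factor)
  also have "\<dots> = qpoch (fls_X ^ m) (2 * N) *
      bailey_sum 0 (\<lambda>j. (- 1) powi j * fls_X powi gordon_exponent k a j) N"
    unfolding coeff[symmetric] by (rule finite_triple_product[symmetric]) simp
  also have "\<dots> = fps_to_fls (qpoch (fps_X ^ m) (2 * N) * theta_quotient m (gordon_exponent k a) N)"
    using fps_to_fls_theta_quotient[OF m, of "gordon_exponent k a" N] gordon_exponent_lower(2)[OF assms(1)]
    by (simp add: fls_times_fps_to_fls fps_to_fls_qpoch)
  finally show ?thesis by (simp only: fps_to_fls_eq_iff)
qed

section \<open>Truncation\<close>

definition eq_upto :: "nat \<Rightarrow> 'a::field fps \<Rightarrow> 'a fps \<Rightarrow> bool" where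
  "eq_upto n f g \<longleftrightarrow> (\<forall>i\<le>n. f $ i = g $ i)"

lemma eq_upto_refl [simp]: "eq_upto n f f"
  by (simp add: eq_upto_def)

lemma eq_upto_sym: "eq_upto n f g \<Longrightarrow> eq_upto n g f"
  by (simp add: eq_upto_def)

lemma eq_upto_trans [trans]: "eq_upto n f g \<Longrightarrow> eq_upto n g h \<Longrightarrow> eq_upto n f h"
  by (simp add: eq_upto_def)

lemma eq_upto_mult: "eq_upto n f f' \<Longrightarrow> eq_upto n g g' \<Longrightarrow> eq_upto n (f * g) (f' * g')"
  unfolding eq_upto_def fps_mult_nth by (auto intro!: sum.cong)

lemma eq_upto_sum:
  "(\<And>x. x \<in> A \<Longrightarrow> eq_upto n (f x) (g x)) \<Longrightarrow> eq_upto n (sum f A) (sum g A)"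
  unfolding eq_upto_def fps_sum_nth by (auto intro!: sum.cong)

lemma eq_upto_fps_X_power: "n < d \<Longrightarrow> eq_upto n (fps_X ^ d) 0"
  by (simp add: eq_upto_def fps_X_power_iff)

lemma eq_upto_cancel:
  assumes "eq_upto n (f * h) (g * h)" and "h $ 0 \<noteq> 0"
  shows "eq_upto n f g"
proof -
  have "h * inverse h = 1"
    using assms(2) by (simp add: inverse_mult_eq_1')
  then have *: "f * h * inverse h = f" "g * h * inverse h = g"
    by (simp_all add: mult.assoc)
  show ?thesis
    using eq_upto_mult[OF assms(1) eq_upto_refl, of "inverse h"] unfolding * .
qed

lemma eq_upto_inverse:
  assumes "eq_upto n f g" and "f $ 0 \<noteq> 0"
  shows "eq_upto n (inverse f) (inverse g)"
proof -
  have g: "g $ 0 \<noteq> 0" using assms by (simp add: eq_upto_def)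
  have "eq_upto n (inverse f * f) (inverse f * g)"
    by (intro eq_upto_mult eq_upto_refl assms)
  then have "eq_upto n (inverse g * g) (inverse f * g)"
    using assms(2) g by (simp add: inverse_mult_eq_1)
  then show ?thesis
    using g by (blast intro: eq_upto_cancel eq_upto_sym)
qed

lemma eq_upto_qpoch:
  assumes "0 < m" and "n \<le> l"
  shows "eq_upto n (qpoch (fps_X ^ m :: rat fps) l) (qpoch (fps_X ^ m) n)"
  using assms(2)
proof (induction l rule: dec_induct)
  case (step l)
  have "n < m * Suc l" using step assms(1) by (cases m) auto
  then have "eq_upto n (1 - (fps_X ^ m :: rat fps) ^ Suc l) 1"
    unfolding power_mult[symmetric] eq_upto_def by (auto simp: fps_X_power_iff simp del: mult_Suc_right)
  from eq_upto_mult[OF step.IH this] show ?case by (simp add: qpoch_Suc)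
qed simp

definition theta_sum :: "(int \<Rightarrow> int) \<Rightarrow> nat \<Rightarrow> rat fps" where
  "theta_sum E N = (\<Sum>j\<in>{- int N..int N}. (- 1) ^ nat \<bar>j\<bar> * fps_X ^ nat (E j))"

text \<open>
  If \<open>\<bar>j\<bar>\<close> is at most \<open>n + 2\<close>, both \<open>N - j\<close> and \<open>N + j\<close> are at least \<open>n\<close>, and all \<open>q\<close>-factorials may be
  replaced by the one of index \<open>n\<close>; otherwise \<open>E j > n\<close> and the term does not contribute at all.
\<close>
lemma theta_quotient_eq_upto:
  assumes m: "0 < m" and E: "\<And>j. \<bar>j\<bar> - 1 \<le> E j" and N: "2 * n + 2 \<le> N" and L: "n \<le> L"
  shows "eq_upto n (qpoch (fps_X ^ m) L * theta_quotient m E N * qpoch (fps_X ^ m) n) (theta_sum E N)"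
proof -
  let ?P = "\<lambda>l. qpoch (fps_X ^ m :: rat fps) l"
  have P0: "?P l $ 0 \<noteq> 0" for l
    using qpoch_fps_nth_0[OF m, of l] by simp
  have inv: "eq_upto n (inverse (?P l)) (inverse (?P n))" if "n \<le> l" for l
    by (intro eq_upto_inverse eq_upto_qpoch m that P0)
  have one: "?P n * inverse (?P n) = 1"
    using P0[of n] by (simp add: inverse_mult_eq_1')
  have "qpoch (fps_X ^ m) L * theta_quotient m E N * qpoch (fps_X ^ m) n =
      (\<Sum>j\<in>{- int N..int N}. (- 1) ^ nat \<bar>j\<bar> * (fps_X ^ nat (E j) *
        (?P L * (inverse (?P (nat (int N - j))) * (inverse (?P (nat (int N + j))) * ?P n)))))"
    unfolding theta_quotient_def sum_distrib_left sum_distrib_right by (simp only: mult_ac)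
  also have "eq_upto n \<dots> (theta_sum E N)"
    unfolding theta_sum_def
  proof (intro eq_upto_sum eq_upto_mult eq_upto_refl)
    fix j assume j: "j \<in> {- int N..int N}"
    let ?g = "?P L * (inverse (?P (nat (int N - j))) * (inverse (?P (nat (int N + j))) * ?P n))"
    show "eq_upto n (fps_X ^ nat (E j) * ?g) (fps_X ^ nat (E j))"
    proof (cases "\<bar>j\<bar> \<le> int n + 2")
      case True
      then have "eq_upto n ?g (?P n * (inverse (?P n) * (inverse (?P n) * ?P n)))"
        using N by (intro eq_upto_mult inv eq_upto_qpoch m L eq_upto_refl) auto
      moreover have "?P n * (inverse (?P n) * (inverse (?P n) * ?P n)) = 1"
        using one by (simp add: mult.commute[of "inverse (?P n)"])
      ultimately have "eq_upto n ?g 1" by simp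
      from eq_upto_mult[OF eq_upto_refl this] show ?thesis by simp
    next
      case False
      then have "n < nat (E j)" using E[of j] by linarith
      then have X: "eq_upto n (fps_X ^ nat (E j) :: rat fps) 0" by (rule eq_upto_fps_X_power)
      from eq_upto_mult[OF X eq_upto_refl, of ?g] have "eq_upto n (fps_X ^ nat (E j) * ?g) 0" by simp
      then show ?thesis using X by (blast intro: eq_upto_trans eq_upto_sym)
    qed
  qed
  finally show ?thesis .
qed

lemma allowed_part_iff_mod:
  assumes "a \<le> k"
  shows "allowed_part k a i \<longleftrightarrow> i mod (2 * k + 3) \<notin> {0, k + 1 - a, k + a + 2}"
proof -
  have "[int i = int c] (mod (2 * int k + 3)) \<longleftrightarrow> i mod (2 * k + 3) = c" if "c < 2 * k + 3" for c
  proof -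
    have "[int i = int c] (mod (2 * int k + 3)) \<longleftrightarrow> [i = c] (mod (2 * k + 3))"
      using cong_int_iff[of i c "2 * k + 3"] by simp
    then show ?thesis using that by (simp add: cong_def)
  qed
  note * = this
  have "[int i = - (int k + 1 - int a)] (mod (2 * int k + 3)) \<longleftrightarrow>
      [int i = int (k + a + 2)] (mod (2 * int k + 3))"
  proof -
    have "int i - int (k + a + 2) = - (2 * int k + 3) + (int i - - (int k + 1 - int a))"
      by simp
    then show ?thesis
      unfolding cong_iff_dvd_diff by (simp only:) (rule dvd_add_right_iff[symmetric]; simp only: dvd_minus_iff dvd_refl)
  qed
  moreover have "int (k + 1 - a) = int k + 1 - int a"
    using assms by simp
  ultimately show ?thesis
    using *[of 0] *[of "k + 1 - a"] *[of "k + a + 2"] assms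
    unfolding allowed_part_def insert_iff empty_iff by (simp only: of_nat_0) simp
qed

text \<open>
  A period \<open>m N < i \<le> m (N + 1)\<close> has just three excluded numbers: \<open>m N + (k + 1 - a)\<close>, \<open>m N + (k + a + 2)\<close> and \<open>m N + m\<close>.
\<close>
lemma excluded_product:
  assumes "a \<le> k"
  defines "m \<equiv> 2 * k + 3"
  shows "(\<Prod>i\<in>{i\<in>{1..m * N}. \<not> allowed_part k a i}. 1 - fps_X ^ i :: rat fps) =
    (\<Prod>i=1..N. (1 - fps_X ^ (m * (i - 1) + (k + 1 - a))) * (1 - fps_X ^ (m * (i - 1) + (k + a + 2)))) *
    qpoch (fps_X ^ m) N"
proof (induction N)
  case (Suc N)
  define c1 c2 where "c1 = k + 1 - a" and "c2 = k + a + 2"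
  have c: "0 < c1" "c1 < c2" "c2 < m"
    using assms(1) by (auto simp: c1_def c2_def m_def)
  have allowed: "allowed_part k a i \<longleftrightarrow> i mod m \<notin> {0, c1, c2}" for i
    unfolding c1_def c2_def m_def by (rule allowed_part_iff_mod[OF assms(1)])
  let ?B = "\<lambda>N. {i\<in>{1..m * N}. \<not> allowed_part k a i}"
  let ?new = "{m * N + c1, m * N + c2, m * N + m}"
  have new: "i \<in> ?new" if i: "m * N < i" "i \<le> m * Suc N" "\<not> allowed_part k a i" for i
  proof -
    define d where "d = i - m * N"
    have d: "i = m * N + d" "0 < d" "d \<le> m"
      using i by (auto simp: d_def)
    have "d mod m \<in> {0, c1, c2}"
      using i(3) unfolding allowed d(1) by simp
    then show ?thesis
      using d by (cases "d = m") auto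
  qed
  have "?B (Suc N) = ?B N \<union> ?new"
  proof (intro equalityI subsetI)
    fix i assume "i \<in> ?B (Suc N)"
    then show "i \<in> ?B N \<union> ?new" using new[of i] by (cases "i \<le> m * N") auto
  next
    fix i assume "i \<in> ?B N \<union> ?new"
    moreover have "\<not> allowed_part k a i" if "i \<in> ?new"
      using that c unfolding allowed by auto
    ultimately show "i \<in> ?B (Suc N)" using c by auto
  qed
  moreover have "?B N \<inter> ?new = {}" using c by auto
  ultimately have "(\<Prod>i\<in>?B (Suc N). 1 - fps_X ^ i :: rat fps) =
      (\<Prod>i\<in>?B N. 1 - fps_X ^ i) * (\<Prod>i\<in>?new. 1 - fps_X ^ i)"
    by (simp only:) (rule prod.union_disjoint; simp)
  also have "(\<Prod>i\<in>?new. 1 - fps_X ^ i :: rat fps) =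
      (1 - fps_X ^ (m * N + c1)) * ((1 - fps_X ^ (m * N + c2)) * (1 - fps_X ^ (m * Suc N)))"
    using c by (simp add: add.commute)
  finally have step: "(\<Prod>i\<in>?B (Suc N). 1 - fps_X ^ i :: rat fps) = (\<Prod>i\<in>?B N. 1 - fps_X ^ i) *
      ((1 - fps_X ^ (m * N + c1)) * ((1 - fps_X ^ (m * N + c2)) * (1 - fps_X ^ (m * Suc N))))" .
  have "qpoch (fps_X ^ m :: rat fps) (Suc N) = qpoch (fps_X ^ m) N * (1 - fps_X ^ (m * Suc N))"
    by (simp only: qpoch_Suc power_mult)
  moreover have "prod f {1..Suc N} = prod f {1..N} * f (Suc N)" for f :: "nat \<Rightarrow> rat fps"
    by simp
  ultimately show ?case
    unfolding step unfolding Suc.IH c1_def c2_def by (simp only: mult_ac diff_Suc_1)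
qed simp

section \<open>Partitions with prescribed parts\<close>

lemma partitions_parts_le: "xs \<in> partitions n \<Longrightarrow> set xs \<subseteq> {1..n}"
  using member_le_sum_list[of _ xs] by (auto simp: partitions_def Suc_le_eq)

lemma finite_partitions [simp]: "finite (partitions n)"
proof (rule finite_subset)
  have "length xs \<le> sum_list xs" if "\<forall>x\<in>set xs. 0 < x" for xs :: "nat list"
    using that by (induction xs) auto
  then have "length xs \<le> n" if "xs \<in> partitions n" for xs
    using that unfolding partitions_def by blast
  then show "partitions n \<subseteq> {xs. set xs \<subseteq> {1..n} \<and> length xs \<le> n}"
    using partitions_parts_le by blast
qed (simp add: finite_lists_length_le)

text \<open>
  As multisets, partitions gain or lose copies of a part without any need for sorting.
\<close>
definition multiset_partitions :: "nat \<Rightarrow> nat multiset set" where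
  "multiset_partitions n = {A. sum_mset A = n \<and> 0 \<notin># A}"

lemma bij_betw_mset_partitions: "bij_betw mset (partitions n) (multiset_partitions n)"
proof (rule bij_betw_byWitness[where f' = "\<lambda>A. rev (sorted_list_of_multiset A)"])
  show "\<forall>xs\<in>partitions n. rev (sorted_list_of_multiset (mset xs)) = xs"
  proof
    fix xs assume "xs \<in> partitions n"
    then have "sorted (rev xs)" by (simp add: partitions_def sorted_wrt_rev)
    then have "sorted_list_of_multiset (mset (rev xs)) = rev xs"
      by (simp only: sorted_list_of_multiset_mset sorted_sort_id)
    then show "rev (sorted_list_of_multiset (mset xs)) = xs" by simp
  qed
  show "mset ` partitions n \<subseteq> multiset_partitions n"
    by (auto simp: partitions_def multiset_partitions_def sum_mset_sum_list)
  show "(\<lambda>A. rev (sorted_list_of_multiset A)) ` multiset_partitions n \<subseteq> partitions n"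
  proof
    fix xs assume "xs \<in> (\<lambda>A. rev (sorted_list_of_multiset A)) ` multiset_partitions n"
    then obtain A where A: "xs = rev (sorted_list_of_multiset A)" "sum_mset A = n" "0 \<notin># A"
      by (auto simp: multiset_partitions_def)
    have "sum_list (sorted_list_of_multiset A) = sum_mset A"
      by (metis mset_sorted_list_of_multiset sum_mset_sum_list)
    then show "xs \<in> partitions n"
      using A by (auto simp: partitions_def sorted_wrt_rev intro: gr0I)
  qed
qed simp

lemma card_partitions_mset:
  "card {xs \<in> partitions n. P (mset xs)} = card {A \<in> multiset_partitions n. P A}"
proof (rule bij_betw_same_card)
  have "mset ` {xs \<in> partitions n. P (mset xs)} = {A \<in> multiset_partitions n. P A}"
    using bij_betw_imp_surj_on[OF bij_betw_mset_partitions[of n]] by auto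
  then show "bij_betw mset {xs \<in> partitions n. P (mset xs)} {A \<in> multiset_partitions n. P A}"
    using bij_betw_mset_partitions[of n] by (auto intro: bij_betw_subset)
qed

definition count_partitions :: "nat set \<Rightarrow> nat \<Rightarrow> nat" where
  "count_partitions S n = card {xs \<in> partitions n. set xs \<subseteq> S}"

lemma card_multiset_partitions_ge:
  assumes "0 < M" and "M \<in> S"
  shows "card {A \<in> multiset_partitions n. set_mset A \<subseteq> S \<and> j \<le> count A M} =
    (if M * j \<le> n then card {A \<in> multiset_partitions (n - M * j). set_mset A \<subseteq> S} else 0)"
proof (cases "M * j \<le> n")
  case True
  let ?X = "{A \<in> multiset_partitions (n - M * j). set_mset A \<subseteq> S}"
  let ?Y = "{A \<in> multiset_partitions n. set_mset A \<subseteq> S \<and> j \<le> count A M}"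
  have "bij_betw (\<lambda>A. A + replicate_mset j M) ?X ?Y"
  proof (rule bij_betw_byWitness[where f' = "\<lambda>A. A - replicate_mset j M"])
    show "\<forall>A\<in>?Y. A - replicate_mset j M + replicate_mset j M = A"
      by (simp add: count_le_replicate_mset_subset_eq)
    show "(\<lambda>A. A + replicate_mset j M) ` ?X \<subseteq> ?Y"
      using assms True by (auto simp: multiset_partitions_def in_replicate_mset mult.commute subset_iff split: if_splits)
    show "(\<lambda>A. A - replicate_mset j M) ` ?Y \<subseteq> ?X"
    proof (rule image_subsetI)
      fix A assume A: "A \<in> ?Y"
      then obtain B where "A = B + replicate_mset j M"
        using count_le_replicate_mset_subset_eq[of j A M]
        by (metis (no_types, lifting) mem_Collect_eq subset_mset.diff_add)
      then show "A - replicate_mset j M \<in> ?X"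
        using A by (auto simp: multiset_partitions_def mult.commute)
    qed
  qed simp
  then show ?thesis using True by (simp add: bij_betw_same_card)
next
  case False
  have "M * j \<le> sum_mset A" if ge: "j \<le> count A M" for A
  proof -
    obtain B where "A = B + replicate_mset j M"
      using ge count_le_replicate_mset_subset_eq[of j A M] by (metis subset_mset.diff_add)
    then show ?thesis by (simp add: mult.commute)
  qed
  then have "{A \<in> multiset_partitions n. set_mset A \<subseteq> S \<and> j \<le> count A M} = {}"
    using False by (auto simp: multiset_partitions_def)
  then show ?thesis using False by (simp only: card.empty if_False)
qed

lemma card_partitions_count_ge:
  assumes "0 < M" and "M \<in> S"
  shows "card {xs \<in> partitions n. set xs \<subseteq> S \<and> j \<le> count_list xs M} =
    (if M * j \<le> n then count_partitions S (n - M * j) else 0)"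
  using card_multiset_partitions_ge[OF assms, of n j]
    card_partitions_mset[of n "\<lambda>A. set_mset A \<subseteq> S \<and> j \<le> count A M"]
    card_partitions_mset[of "n - M * j" "\<lambda>A. set_mset A \<subseteq> S"]
  by (simp add: count_partitions_def count_mset)

lemma card_partitions_count_eq:
  assumes "0 < M" and "M \<in> S"
  shows "card {xs \<in> partitions n. set xs \<subseteq> S \<and> count_list xs M = j} +
      (if M * Suc j \<le> n then count_partitions S (n - M * Suc j) else 0) =
    (if M * j \<le> n then count_partitions S (n - M * j) else 0)"
proof -
  have "{xs \<in> partitions n. set xs \<subseteq> S \<and> j \<le> count_list xs M} =
      {xs \<in> partitions n. set xs \<subseteq> S \<and> count_list xs M = j} \<union>
      {xs \<in> partitions n. set xs \<subseteq> S \<and> Suc j \<le> count_list xs M}"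
    by auto
  then have "card {xs \<in> partitions n. set xs \<subseteq> S \<and> j \<le> count_list xs M} =
      card {xs \<in> partitions n. set xs \<subseteq> S \<and> count_list xs M = j} +
      card {xs \<in> partitions n. set xs \<subseteq> S \<and> Suc j \<le> count_list xs M}"
    by (simp only:) (rule card_Un_disjoint; auto)
  then show ?thesis
    using card_partitions_count_ge[OF assms, of n] by simp
qed

definition partition_gf :: "nat set \<Rightarrow> rat fps" where
  "partition_gf S = Abs_fps (\<lambda>n. of_nat (count_partitions S n))"

text \<open>
  The case \<open>j = 0\<close> of the previous count: the partitions avoiding \<open>M\<close> are those with parts in \<open>S\<close>.
\<close>
lemma partition_gf_insert:
  assumes "0 < M" and "M \<notin> S"
  shows "partition_gf (insert M S) * (1 - fps_X ^ M) = partition_gf S"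
proof (rule fps_ext)
  fix n
  have "{xs \<in> partitions n. set xs \<subseteq> insert M S \<and> count_list xs M = 0} = {xs \<in> partitions n. set xs \<subseteq> S}"
    using assms(2) by (auto simp: count_list_0_iff)
  then have "count_partitions S n + (if M \<le> n then count_partitions (insert M S) (n - M) else 0) =
      count_partitions (insert M S) n"
    using card_partitions_count_eq[OF assms(1), of "insert M S" n 0]
    unfolding count_partitions_def[of S] One_nat_def[symmetric] mult_1_right
    by (simp add: count_partitions_def[of _ n])
  then have "(of_nat (count_partitions S n) :: rat) =
      of_nat (count_partitions (insert M S) n) -
      (if M \<le> n then of_nat (count_partitions (insert M S) (n - M)) else 0)"
    by (auto simp flip: of_nat_add split: if_splits)
  then show "(partition_gf (insert M S) * (1 - fps_X ^ M)) $ n = partition_gf S $ n"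
    by (simp add: partition_gf_def right_diff_distrib fps_X_power_mult_right_nth)
qed

lemma partition_gf_mult_prod:
  assumes "finite S" and "0 \<notin> S"
  shows "partition_gf S * (\<Prod>i\<in>S. 1 - fps_X ^ i) = 1"
  using assms
proof (induction S rule: finite_induct)
  case empty
  have "{xs \<in> partitions n. set xs \<subseteq> {}} = (if n = 0 then {[]} else {})" for n
    by (auto simp: partitions_def)
  then show ?case
    by (intro fps_ext) (simp add: partition_gf_def count_partitions_def)
next
  case (insert M S)
  then show ?case
    using partition_gf_insert[of M S] by (simp add: mult.assoc[symmetric])
qed

section \<open>Andrews--Gordon identity\<close>

definition dissections :: "nat list \<Rightarrow> nat \<Rightarrow> (nat list \<times> nat list) set" where
  "dissections es n = {(ns, xs). dissected n es ns xs \<and> sum_list xs = n}"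

lemma inj_on_snd_dissections: "inj_on snd (dissections es n)"
  using dissected_unique by (fastforce simp: dissections_def inj_on_def)

lemma dissected_change_bound:
  assumes "dissected N es ns xs" and "set xs \<subseteq> {..N'}"
  shows "dissected N' es ns xs"
proof (cases "(N, es, ns, xs)" rule: dissected.cases)
  case (3 _ e es' m ns' _)
  then obtain us zs where xs: "0 < m" "xs = us @ replicate e m @ zs" "us \<in> box_lists m m N"
    "dissected m es' ns' zs" using assms(1) by auto
  then have "us \<in> box_lists m m N'"
    using assms(2) by (auto simp: box_lists_def subset_iff)
  then show ?thesis using 3 xs by auto
qed (use assms in auto)

lemma dissected_lists_nth:
  assumes "n \<le> N"
  shows "(\<Sum>xs\<in>dissected_lists N es. fps_X ^ sum_list xs :: rat fps) $ n = of_nat (card (dissections es n))"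
proof -
  have "(\<Sum>xs\<in>dissected_lists N es. fps_X ^ sum_list xs :: rat fps) $ n =
      (\<Sum>xs\<in>dissected_lists N es. if sum_list xs = n then 1 else 0)"
    by (auto simp: fps_sum_nth intro!: sum.cong)
  also have "\<dots> = of_nat (card {xs \<in> dissected_lists N es. sum_list xs = n})"
    by (simp add: sum.If_cases Int_def)
  also have "{xs \<in> dissected_lists N es. sum_list xs = n} = snd ` dissections es n"
  proof (intro equalityI subsetI)
    fix xs assume "xs \<in> {xs \<in> dissected_lists N es. sum_list xs = n}"
    then obtain ns where ns: "dissected N es ns xs" "sum_list xs = n"
      by (auto simp: dissected_lists_def)
    then have "dissected n es ns xs"
      using member_le_sum_list[of _ xs] by (intro dissected_change_bound[OF ns(1)]) auto
    then show "xs \<in> snd ` dissections es n"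
      using ns(2) by (force simp: dissections_def)
  next
    fix xs assume "xs \<in> snd ` dissections es n"
    then obtain ns where ns: "dissected n es ns xs" "sum_list xs = n"
      by (auto simp: dissections_def)
    have "set xs \<subseteq> {..N}"
      using dissected_partition[OF ns(1)] assms by auto
    then have "dissected N es ns xs"
      by (rule dissected_change_bound[OF ns(1)])
    then show "xs \<in> {xs \<in> dissected_lists N es. sum_list xs = n}"
      using ns(2) by (auto simp: dissected_lists_def)
  qed
  also have "card (snd ` dissections es n) = card (dissections es n)"
    by (rule card_image[OF inj_on_snd_dissections])
  finally show ?thesis .
qed

text \<open>
  Let \<open>V\<close> be the polynomial of the admissible partitions with parts at most \<open>N\<close>, \<open>A\<close> and \<open>E\<close> the products of \<open>1 - q\<^sup>i\<close>
  over the allowed and the excluded \<open>i \<le> m N\<close>, and \<open>\<Theta>\<close> the theta series. Up to order \<open>n\<close>, the chain yields \<open>V (q)\<^sub>n = \<Theta>\<close>, the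
  triple product yields \<open>E = \<Theta>\<close>, and \<open>(q)\<^sub>n = (q)\<^bsub>m N\<^esub> = A E\<close>. Therefore \<open>V A E = E\<close> and \<open>V = 1 / A\<close>.
\<close>
theorem andrews_gordon:
  assumes "a \<le> k"
  shows "card (dissections (row_flags k a) n) = count_partitions {i. allowed_part k a i} n"
proof -
  define m N where "m = 2 * k + 3" and "N = 2 * n + 2"
  have m: "0 < m" by (simp add: m_def)
  define S where "S = {i\<in>{1..m * N}. allowed_part k a i}"
  let ?excl = "{i\<in>{1..m * N}. \<not> allowed_part k a i}"
  define V :: "rat fps" where "V = (\<Sum>xs\<in>dissected_lists N (row_flags k a). fps_X ^ sum_list xs)"
  define R :: "rat fps" where "R = (\<Prod>i=1..N.
    (1 - fps_X ^ (m * (i - 1) + (k + 1 - a))) * (1 - fps_X ^ (m * (i - 1) + (k + a + 2))))"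
  let ?\<Theta> = "theta_sum (gordon_exponent k a) N"
  let ?A = "\<Prod>i\<in>S. 1 - fps_X ^ i :: rat fps"
  let ?E = "\<Prod>i\<in>?excl. 1 - fps_X ^ i :: rat fps"
  let ?P = "\<lambda>m l. qpoch (fps_X ^ m) l :: rat fps"
  note low = gordon_exponent_lower(1)[OF assms]
  have "V = ?P 1 N * theta_quotient 1 (gordon_exponent k a) N"
    unfolding V_def dissected_lists_theta[OF assms] by simp
  then have V: "eq_upto n (V * ?P 1 n) ?\<Theta>"
    using theta_quotient_eq_upto[of 1 "gordon_exponent k a" n N N] low by (simp add: N_def)
  have R: "eq_upto n (R * ?P m n) ?\<Theta>"
    using theta_quotient_eq_upto[of m "gordon_exponent k a" n N "2 * N"] low m
    unfolding R_def m_def residue_product_theta[OF assms] by (simp add: N_def)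
  have "?E = R * ?P m N"
    unfolding R_def m_def by (rule excluded_product[OF assms])
  then have E: "eq_upto n ?E (R * ?P m n)"
    using eq_upto_mult[OF eq_upto_refl eq_upto_qpoch[OF m, of n N], of R] by (simp add: N_def)
  have split: "?P 1 (m * N) = ?A * ?E"
  proof -
    have "(\<Prod>i\<in>S \<union> ?excl. 1 - fps_X ^ i :: rat fps) = ?A * ?E"
      by (rule prod.union_disjoint) (auto simp: S_def)
    moreover have "S \<union> ?excl = {1..m * N}" by (auto simp: S_def)
    ultimately show ?thesis by (simp only: qpoch_def power_one_right)
  qed
  have "(?A * ?E) $ 0 = 1"
    unfolding split[symmetric] by (rule qpoch_fps_nth_0) simp
  then have nz: "?A $ 0 \<noteq> 0" "?E $ 0 \<noteq> 0" by auto
  have "n \<le> m * N" using m by (cases m) (auto simp: N_def)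
  then have "eq_upto n (?P 1 (m * N)) (?P 1 n)"
    by (intro eq_upto_qpoch) simp
  then have "eq_upto n (V * (?A * ?E)) (V * ?P 1 n)"
    unfolding split by (rule eq_upto_mult[OF eq_upto_refl])
  also note V
  also note eq_upto_sym[OF R]
  also note eq_upto_sym[OF E]
  finally have "eq_upto n ((V * ?A) * ?E) (1 * ?E)"
    by (simp add: mult.assoc)
  then have "eq_upto n (V * ?A) 1"
    using nz(2) by (rule eq_upto_cancel)
  moreover have "partition_gf S * ?A = 1"
    by (rule partition_gf_mult_prod) (auto simp: S_def)
  ultimately have "eq_upto n (V * ?A) (partition_gf S * ?A)" by simp
  then have "eq_upto n V (partition_gf S)"
    using nz(1) by (rule eq_upto_cancel)
  then have "V $ n = partition_gf S $ n"
    by (simp add: eq_upto_def)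
  moreover have "V $ n = of_nat (card (dissections (row_flags k a) n))"
    unfolding V_def by (rule dissected_lists_nth) (simp add: N_def)
  moreover have "count_partitions S n = count_partitions {i. allowed_part k a i} n"
  proof -
    have "xs \<in> partitions n \<Longrightarrow> set xs \<subseteq> S \<longleftrightarrow> set xs \<subseteq> {i. allowed_part k a i}" for xs
      using partitions_parts_le[of xs n] \<open>n \<le> m * N\<close> by (auto simp: S_def)
    then show ?thesis unfolding count_partitions_def by (metis (no_types, lifting))
  qed
  ultimately show ?thesis
    by (simp add: partition_gf_def)
qed

section \<open>Moving the first part\<close>

text \<open>
  How far \<open>\<lambda>\<^sub>1\<close> lies above the smallest value that it can take with all other parts and the rectangles kept.
\<close>
definition first_part_slack :: "nat list \<Rightarrow> nat list \<Rightarrow> nat" where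
  "first_part_slack ns xs = (if 2 \<le> ns ! 0 then xs ! 0 - xs ! 1 else xs ! 0 - 1)"

fun raise_first_part :: "nat \<Rightarrow> nat list \<times> nat list \<Rightarrow> nat list \<times> nat list" where
  "raise_first_part t (ns, xs) = (ns, (hd xs + t) # tl xs)"

fun lower_first_part :: "nat \<Rightarrow> nat list \<times> nat list \<Rightarrow> nat list \<times> nat list" where
  "lower_first_part t (ns, xs) = (ns, (hd xs - t) # tl xs)"

text \<open>
  If \<open>m \<ge> 2\<close>, the second row belongs to the free rows of the first rectangle as well and reaches at least to column \<open>m\<close>,
  so that only the order of the parts restricts the first one. If \<open>m = 1\<close>, the first row is the only free row, and
  all parts below are equal to \<open>1\<close>.
\<close>
lemma dissected_change_first_part:
  assumes "dissected N (e # es) (m # ns) (x # xs)"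
    and "(if 2 \<le> m then xs ! 0 else 1) \<le> y" and "y \<le> N'"
  shows "dissected N' (e # es) (m # ns) (y # xs)"
proof -
  from assms(1) obtain us zs where m: "0 < m" and eq: "x # xs = us @ replicate e m @ zs"
    and us: "us \<in> box_lists m m N" and zs: "dissected m es ns zs" by auto
  then obtain us' where us': "us = x # us'"
    by (cases us) (auto simp: box_lists_def)
  then have xs: "xs = us' @ replicate e m @ zs" using eq by simp
  have "y # us' \<in> box_lists m m N'"
  proof (cases us')
    case Nil
    then show ?thesis using us us' assms(2,3) by (simp add: box_lists_def)
  next
    case (Cons u us'')
    then have "u \<le> y" using assms(2) us us' by (simp add: xs box_lists_def split: if_splits)
    then have "\<forall>v\<in>set us'. v \<le> y"
      using us us' Cons by (fastforce simp: box_lists_def)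
    then show ?thesis
      using us us' Cons \<open>u \<le> y\<close> assms(3) by (fastforce simp: box_lists_def)
  qed
  then show ?thesis
    unfolding dissected.simps using m zs xs by (metis append_Cons)
qed

lemma dissected_first_part_lower:
  assumes "dissected N (e # es) (m # ns) (x # xs)"
  shows "(if 2 \<le> m then xs ! 0 else 1) \<le> x"
proof (cases "2 \<le> m")
  case True
  from assms obtain us zs where "x # xs = us @ replicate e m @ zs" "us \<in> box_lists m m N" by auto
  then have "2 \<le> length (x # xs)" using True by (simp add: box_lists_def)
  then have "xs ! 0 \<in> set xs" by (cases xs) auto
  moreover have "sorted_wrt (\<ge>) (x # xs)" using dissected_partition[OF assms] by simp
  ultimately show ?thesis using True by auto
next
  case False
  then show ?thesis using dissected_partition[OF assms] by auto
qed

text \<open>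
  With at least two columns or at least two rectangles, the first part ranges over an unbounded interval when
  everything else is kept.
\<close>
definition large_dissections :: "nat list \<Rightarrow> nat \<Rightarrow> (nat list \<times> nat list) set" where
  "large_dissections es n = {(ns, xs) \<in> dissections es n. ns \<noteq> [] \<and> (2 \<le> ns ! 0 \<or> 2 \<le> length ns)}"

definition small_dissections :: "nat list \<Rightarrow> nat \<Rightarrow> (nat list \<times> nat list) set" where
  "small_dissections es n = {(ns, xs) \<in> dissections es n. ns = [] \<or> (ns ! 0 < 2 \<and> length ns = 1)}"

lemma finite_dissections [simp]: "finite (dissections es n)"
proof (rule finite_imageD)
  have "snd ` dissections es n \<subseteq> dissected_lists n es"
    by (auto simp: dissections_def dissected_lists_def)
  then show "finite (snd ` dissections es n)"
    by (rule finite_subset) simp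
qed (rule inj_on_snd_dissections)

lemma dissections_split:
  "dissections es n = large_dissections es n \<union> small_dissections es n"
  "large_dissections es n \<inter> small_dissections es n = {}"
  by (auto simp: large_dissections_def small_dissections_def Suc_le_eq neq_Nil_conv not_less_eq_eq
      numeral_2_eq_2 length_Suc_conv)

lemma card_dissections:
  "card (dissections es n) = card (large_dissections es n) + card (small_dissections es n)"
proof -
  have "finite (large_dissections es n)" "finite (small_dissections es n)"
    using finite_dissections[of es n] unfolding dissections_split(1) by auto
  then show ?thesis
    unfolding dissections_split(1) using dissections_split(2) by (intro card_Un_disjoint)
qed

lemma large_dissectionsE:
  assumes "(ns, xs) \<in> large_dissections (e # es) n"
  obtains m ns' x xs' where "ns = m # ns'" "xs = x # xs'" "0 < m"
    "dissected n (e # es) (m # ns') (x # xs')" "x + sum_list xs' = n"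
    "2 \<le> m \<or> 2 \<le> length ns" "first_part_slack ns xs = x - (if 2 \<le> m then xs' ! 0 else 1)"
proof -
  from assms obtain m ns' where ns: "ns = m # ns'" and d: "dissected n (e # es) ns xs"
    and "sum_list xs = n" "2 \<le> m \<or> 2 \<le> length ns"
    by (cases ns) (auto simp: large_dissections_def dissections_def)
  moreover have "0 < m" "xs \<noteq> []" using d unfolding ns by (auto simp: box_lists_def)
  ultimately show ?thesis
    using that by (cases xs) (auto simp: first_part_slack_def)
qed

lemma large_dissectionsI:
  assumes "dissected n es ns xs" "sum_list xs = n" "ns \<noteq> []" "2 \<le> ns ! 0 \<or> 2 \<le> length ns"
  shows "(ns, xs) \<in> large_dissections es n"
  using assms by (auto simp: large_dissections_def dissections_def)

text \<open>
  Raising the first part by \<open>t\<close> maps the dissections of \<open>n - t\<close> bijectively onto those dissections of \<open>n\<close> with slack at least \<open>t\<close>.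
\<close>
lemma card_large_dissections_slack_ge:
  "card {(ns, xs) \<in> large_dissections (e # es) n. t \<le> first_part_slack ns xs} =
    (if t \<le> n then card (large_dissections (e # es) (n - t)) else 0)"
proof (cases "t \<le> n")
  case True
  let ?Y = "{(ns, xs) \<in> large_dissections (e # es) n. t \<le> first_part_slack ns xs}"
  have "bij_betw (raise_first_part t) (large_dissections (e # es) (n - t)) ?Y"
  proof (rule bij_betw_byWitness[where f' = "lower_first_part t"])
    show "\<forall>p\<in>large_dissections (e # es) (n - t). lower_first_part t (raise_first_part t p) = p"
      by (auto elim!: large_dissectionsE)
    show "\<forall>p\<in>?Y. raise_first_part t (lower_first_part t p) = p"
      by (auto elim!: large_dissectionsE)
    show "raise_first_part t ` large_dissections (e # es) (n - t) \<subseteq> ?Y"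
    proof (rule image_subsetI)
      fix p assume "p \<in> large_dissections (e # es) (n - t)"
      then obtain ns xs where p: "p = (ns, xs)" "(ns, xs) \<in> large_dissections (e # es) (n - t)"
        by (cases p) simp
      from p(2) obtain m ns' x xs' where *: "ns = m # ns'" "xs = x # xs'" "0 < m"
        "dissected (n - t) (e # es) (m # ns') (x # xs')" "x + sum_list xs' = n - t"
        "2 \<le> m \<or> 2 \<le> length ns" by (rule large_dissectionsE)
      have lo: "(if 2 \<le> m then xs' ! 0 else 1) \<le> x"
        using *(4) by (rule dissected_first_part_lower)
      have "dissected n (e # es) (m # ns') ((x + t) # xs')"
        using *(4) by (rule dissected_change_first_part) (use lo *(5) True in auto)
      then have "(ns, (x + t) # xs') \<in> large_dissections (e # es) n"
        using * True by (intro large_dissectionsI) auto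
      moreover have "t \<le> first_part_slack ns ((x + t) # xs')"
        using lo *(1) by (auto simp: first_part_slack_def split: if_splits)
      ultimately show "raise_first_part t p \<in> ?Y"
        using *(2) p(1) by simp
    qed
    show "lower_first_part t ` ?Y \<subseteq> large_dissections (e # es) (n - t)"
    proof (rule image_subsetI)
      fix p assume "p \<in> ?Y"
      then obtain ns xs where p: "p = (ns, xs)" "(ns, xs) \<in> large_dissections (e # es) n"
        and t: "t \<le> first_part_slack ns xs" by (cases p) simp
      from p(2) obtain m ns' x xs' where *: "ns = m # ns'" "xs = x # xs'" "0 < m"
        "dissected n (e # es) (m # ns') (x # xs')" "x + sum_list xs' = n"
        "2 \<le> m \<or> 2 \<le> length ns" "first_part_slack ns xs = x - (if 2 \<le> m then xs' ! 0 else 1)"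
        by (elim large_dissectionsE)
      have lo: "(if 2 \<le> m then xs' ! 0 else 1) \<le> x"
        using *(4) by (rule dissected_first_part_lower)
      then have lo': "(if 2 \<le> m then xs' ! 0 else 1) \<le> x - t" and "t \<le> x"
        using t *(7) by auto
      have "dissected (n - t) (e # es) (m # ns') ((x - t) # xs')"
        using *(4) lo' by (rule dissected_change_first_part) (use *(5) \<open>t \<le> x\<close> in auto)
      then have "(ns, (x - t) # xs') \<in> large_dissections (e # es) (n - t)"
        using * \<open>t \<le> x\<close> by (intro large_dissectionsI) auto
      then show "lower_first_part t p \<in> large_dissections (e # es) (n - t)"
        using *(2) p(1) by simp
    qed
  qed
  then show ?thesis using True by (simp add: bij_betw_same_card)
next
  case False
  have "first_part_slack ns xs \<le> n" if "(ns, xs) \<in> large_dissections (e # es) n" for ns xs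
    using that by (auto elim!: large_dissectionsE)
  then have "{(ns, xs) \<in> large_dissections (e # es) n. t \<le> first_part_slack ns xs} = {}"
    using False by (auto dest: order_trans)
  then show ?thesis using False by (simp only: card.empty if_False)
qed

lemma card_large_dissections_slack_div:
  assumes "0 < M"
  shows "card {(ns, xs) \<in> large_dissections (e # es) n. first_part_slack ns xs div M = j} +
      (if M * Suc j \<le> n then card (large_dissections (e # es) (n - M * Suc j)) else 0) =
    (if M * j \<le> n then card (large_dissections (e # es) (n - M * j)) else 0)"
proof -
  let ?B = "large_dissections (e # es) n"
  have fin: "finite ?B"
    using finite_dissections[of "e # es" n] unfolding dissections_split(1) by auto
  have div: "d div M = j \<longleftrightarrow> M * j \<le> d \<and> \<not> M * Suc j \<le> d" for d
  proof -
    have "d div M = j \<longleftrightarrow> j \<le> d div M \<and> \<not> Suc j \<le> d div M" by auto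
    then show ?thesis
      unfolding less_eq_div_iff_mult_less_eq[OF assms] by (simp only: mult.commute)
  qed
  have "{(ns, xs) \<in> ?B. M * j \<le> first_part_slack ns xs} =
      {(ns, xs) \<in> ?B. first_part_slack ns xs div M = j} \<union>
      {(ns, xs) \<in> ?B. M * Suc j \<le> first_part_slack ns xs}"
    unfolding div by auto
  then have "card {(ns, xs) \<in> ?B. M * j \<le> first_part_slack ns xs} =
      card {(ns, xs) \<in> ?B. first_part_slack ns xs div M = j} +
      card {(ns, xs) \<in> ?B. M * Suc j \<le> first_part_slack ns xs}"
    by (simp only:) (rule card_Un_disjoint; use fin in \<open>auto simp: div intro: finite_subset[of _ ?B]\<close>)
  then show ?thesis
    unfolding card_large_dissections_slack_ge by simp
qed

section \<open>Dissections with at most one rectangle, of width one\<close>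

lemma small_dissections_eq:
  assumes "e \<in> {0, 1}"
  shows "small_dissections (e # es) n =
    (if n = 0 then {([], [])} else if e < n then {([1], (n - e) # replicate e 1)} else {})"
proof -
  have "(ns, xs) \<in> small_dissections (e # es) n \<longleftrightarrow>
      (n = 0 \<and> ns = [] \<and> xs = []) \<or>
      (e < n \<and> ns = [1] \<and> xs = (n - e) # replicate e 1)" for ns xs
  proof (cases ns)
    case Nil
    then show ?thesis by (auto simp: small_dissections_def dissections_def)
  next
    case (Cons m ns')
    have "us \<in> box_lists 1 1 n \<longleftrightarrow> (\<exists>u\<in>{1..n}. us = [u])" for us
      by (auto simp: box_lists_def length_Suc_conv)
    then have one: "dissected n (e # es) [1] xs \<longleftrightarrow> (\<exists>u\<in>{1..n}. xs = u # replicate e 1)"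
      by auto
    have "(ns, xs) \<in> small_dissections (e # es) n \<longleftrightarrow>
        ns = [1] \<and> dissected n (e # es) [1] xs \<and> sum_list xs = n"
    proof (cases "m = 1 \<and> ns' = []")
      case True
      then show ?thesis unfolding Cons small_dissections_def dissections_def by simp
    next
      case False
      then show ?thesis unfolding Cons small_dissections_def dissections_def by auto
    qed
    also have "\<dots> \<longleftrightarrow> ns = [1] \<and> e < n \<and> xs = (n - e) # replicate e 1"
      unfolding one by (auto simp: sum_list_replicate)
    finally show ?thesis using Cons by auto
  qed
  then show ?thesis by auto
qed

lemma card_small_dissections:
  assumes "e \<in> {0, 1}"
  shows "card (small_dissections (e # es) n) = (if n = 0 \<or> e < n then 1 else 0)"
  unfolding small_dissections_eq[OF assms] by simp

lemma row_flags_Cons: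
  assumes "1 \<le> k" and "a \<le> k"
  obtains es where "row_flags k a = (if a < k then 0 else 1) # es"
proof (cases "a < k")
  case True
  then obtain l where "k - a = Suc l" by (metis Suc_diff_Suc)
  then show ?thesis using that True by (simp add: row_flags_def)
next
  case False
  then obtain b where "a = Suc b" "a = k" using assms by (cases a) auto
  then show ?thesis using that by (simp add: row_flags_def)
qed

section \<open>Partitions with a fixed number of occurrences of a part\<close>

theorem theorem4p6:
  fixes k a M n j :: nat
  assumes "k \<ge> 1" and "a \<le> k" and "M \<ge> 1" and "allowed_part k a M" and "n \<ge> 1"
  shows "card {xs \<in> partitions n. (\<forall>x\<in>set xs. allowed_part k a x) \<and> count_list xs M = j} =
    card {xs \<in> partitions n. \<exists>ns. admissible_with k a ns xs \<and>
      (length ns = 1 \<and> ns ! 0 = 1 \<and> a < k \<longrightarrow>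
         (\<exists>i\<in>{0..M - 1}. xs = [M * j + i])) \<and>
      (length ns = 1 \<and> ns ! 0 = 1 \<and> a = k \<longrightarrow>
         (\<exists>p. xs = [p, 1]) \<and>
         (n = M * j \<or> (\<exists>i\<in>{2..M - 1}. n = M * j + i) \<or> n = M * j + (M + 1))) \<and>
      (ns ! 0 = 1 \<and> length ns \<ge> 2 \<longrightarrow> (xs ! 0 - ns ! 0) div M = j) \<and>
      (ns ! 0 \<ge> 2 \<longrightarrow> (xs ! 0 - xs ! 1) div M = j)}"
proof -
  define cond where "cond ns xs \<longleftrightarrow>
      (length ns = 1 \<and> ns ! 0 = 1 \<and> a < k \<longrightarrow>
         (\<exists>i\<in>{0..M - 1}. xs = [M * j + i])) \<and>
      (length ns = 1 \<and> ns ! 0 = 1 \<and> a = k \<longrightarrow>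
         (\<exists>p. xs = [p, 1]) \<and>
         (n = M * j \<or> (\<exists>i\<in>{2..M - 1}. n = M * j + i) \<or> n = M * j + (M + 1))) \<and>
      (ns ! 0 = 1 \<and> length ns \<ge> 2 \<longrightarrow> (xs ! 0 - ns ! 0) div M = j) \<and>
      (ns ! 0 \<ge> 2 \<longrightarrow> (xs ! 0 - xs ! 1) div M = j)" for ns xs :: "nat list"
  define e :: nat where "e = (if a < k then 0 else 1)"
  obtain es where es: "row_flags k a = e # es"
    using assms(1,2) unfolding e_def by (rule row_flags_Cons)
  have e01: "e \<in> {0, 1}" by (simp add: e_def)
  let ?L = "large_dissections (e # es)" and ?S = "small_dissections (e # es)"
  let ?P = "count_partitions {i. allowed_part k a i}"
  have total: "?P i = card (?L i) + card (?S i)" for i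
    unfolding andrews_gordon[OF assms(2), symmetric] es card_dissections ..
  have lhs: "card {xs \<in> partitions n. (\<forall>x\<in>set xs. allowed_part k a x) \<and> count_list xs M = j} +
      (if M * Suc j \<le> n then ?P (n - M * Suc j) else 0) = (if M * j \<le> n then ?P (n - M * j) else 0)"
  proof -
    have "{xs \<in> partitions n. (\<forall>x\<in>set xs. allowed_part k a x) \<and> count_list xs M = j} =
        {xs \<in> partitions n. set xs \<subseteq> {i. allowed_part k a i} \<and> count_list xs M = j}"
      by auto
    then show ?thesis
      by (simp only:) (rule card_partitions_count_eq; use assms(3,4) in simp)
  qed
  have "{xs \<in> partitions n. \<exists>ns. admissible_with k a ns xs \<and> cond ns xs} =
      snd ` {(ns, xs) \<in> dissections (e # es) n. cond ns xs}"
  proof (intro equalityI subsetI)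
    fix xs assume "xs \<in> {xs \<in> partitions n. \<exists>ns. admissible_with k a ns xs \<and> cond ns xs}"
    then obtain ns where xs: "xs \<in> partitions n" "admissible_with k a ns xs" "cond ns xs" by auto
    then have "dissected n (e # es) ns xs"
      using admissible_with_iff_dissected[OF _ partitions_parts_le assms(2), of xs n ns]
      by (simp add: partitions_def es)
    then have "(ns, xs) \<in> {(ns, xs) \<in> dissections (e # es) n. cond ns xs}"
      using xs by (simp add: dissections_def partitions_def)
    then show "xs \<in> snd ` {(ns, xs) \<in> dissections (e # es) n. cond ns xs}"
      by (rule rev_image_eqI) simp
  next
    fix xs assume "xs \<in> snd ` {(ns, xs) \<in> dissections (e # es) n. cond ns xs}"
    then obtain ns where ns: "dissected n (e # es) ns xs" "sum_list xs = n" "cond ns xs"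
      by (auto simp: dissections_def)
    have *: "sorted_wrt (\<ge>) xs" "set xs \<subseteq> {1..n}"
      using dissected_partition[OF ns(1)] by auto
    then have "xs \<in> partitions n" using ns(2) by (auto simp: partitions_def)
    moreover have "admissible_with k a ns xs"
      using ns(1) admissible_with_iff_dissected[OF * assms(2)] by (simp add: es)
    ultimately show "xs \<in> {xs \<in> partitions n. \<exists>ns. admissible_with k a ns xs \<and> cond ns xs}"
      using ns(3) by blast
  qed
  then have "card {xs \<in> partitions n. \<exists>ns. admissible_with k a ns xs \<and> cond ns xs} =
      card {(ns, xs) \<in> dissections (e # es) n. cond ns xs}"
    by (simp only:) (rule card_image, rule inj_on_subset[OF inj_on_snd_dissections], auto)
  also have "{(ns, xs) \<in> dissections (e # es) n. cond ns xs} =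
      {(ns, xs) \<in> ?L n. cond ns xs} \<union> {(ns, xs) \<in> ?S n. cond ns xs}"
    using dissections_split(1)[of "e # es" n] by auto
  also have "card \<dots> = card {(ns, xs) \<in> ?L n. cond ns xs} + card {(ns, xs) \<in> ?S n. cond ns xs}"
  proof (rule card_Un_disjoint)
    have "finite (?L n \<union> ?S n)" unfolding dissections_split(1)[symmetric] by simp
    then show "finite {(ns, xs) \<in> ?L n. cond ns xs}" "finite {(ns, xs) \<in> ?S n. cond ns xs}"
      by (auto elim: rev_finite_subset)
    show "{(ns, xs) \<in> ?L n. cond ns xs} \<inter> {(ns, xs) \<in> ?S n. cond ns xs} = {}"
      using dissections_split(2)[of "e # es" n] by auto
  qed
  also have "{(ns, xs) \<in> ?L n. cond ns xs} = {(ns, xs) \<in> ?L n. first_part_slack ns xs div M = j}"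
  proof -
    have "cond ns xs \<longleftrightarrow> first_part_slack ns xs div M = j" if "(ns, xs) \<in> ?L n" for ns xs
      using that by (rule large_dissectionsE) (auto simp: cond_def first_part_slack_def)
    then show ?thesis by auto
  qed
  finally have rhs: "card {xs \<in> partitions n. \<exists>ns. admissible_with k a ns xs \<and> cond ns xs} =
      card {(ns, xs) \<in> ?L n. first_part_slack ns xs div M = j} +
      card {(ns, xs) \<in> ?S n. cond ns xs}" .
  have large: "card {(ns, xs) \<in> ?L n. first_part_slack ns xs div M = j} +
      (if M * Suc j \<le> n then card (?L (n - M * Suc j)) else 0) =
      (if M * j \<le> n then card (?L (n - M * j)) else 0)"
    using assms(3) by (intro card_large_dissections_slack_div) simp
  \<comment> \<open>The same difference for the at most one dissection of each size with \<open>r \<le> 1\<close> and \<open>n\<^sub>1 = 1\<close>\<close>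
  have small: "card {(ns, xs) \<in> ?S n. cond ns xs} +
      (if M * Suc j \<le> n then card (?S (n - M * Suc j)) else 0) =
      (if M * j \<le> n then card (?S (n - M * j)) else 0)"
  proof (cases "a < k")
    case True
    then have e: "e = 0" by (simp add: e_def)
    have "?S n = {([1], [n])}"
      unfolding small_dissections_eq[OF e01] using e assms(5) by simp
    moreover have "cond [1] [n] \<longleftrightarrow> M * j \<le> n \<and> n < M * Suc j"
    proof -
      have "(\<exists>i\<in>{0..M - 1}. n = M * j + i) \<longleftrightarrow> M * j \<le> n \<and> n < M * Suc j"
        using assms(3) by (auto intro!: bexI[of _ "n - M * j"])
      then show ?thesis using True by (simp add: cond_def)
    qed
    ultimately have "{(ns, xs) \<in> ?S n. cond ns xs} =
        (if M * j \<le> n \<and> n < M * Suc j then {([1], [n])} else {})"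
      by auto
    then show ?thesis
      unfolding card_small_dissections[OF e01] using e by auto
  next
    case False
    then have ak: "a = k" and e: "e = 1" using assms(2) by (auto simp: e_def)
    \<comment> \<open>With \<open>a = k\<close> the excluded residues are \<open>0\<close>, \<open>1\<close> and \<open>-1\<close>. For \<open>M = 1\<close> the
      difference would be \<open>-1\<close> at \<open>n = j + 1\<close>, which is not a number of partitions.\<close>
    have "M \<noteq> 1"
      using assms(4) unfolding ak allowed_part_def by auto
    then have M: "2 \<le> M" using assms(3) by simp
    define t where "t = M * j"
    have t: "M * Suc j = t + M" "t = 0 \<or> 2 \<le> t"
      using M by (cases j; auto simp: t_def)+
    let ?Q = "n = t \<or> t + 2 \<le> n \<and> n < t + M \<or> n = t + M + 1"
    have S: "?S n = (if 1 < n then {([1], [n - 1, 1])} else {})"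
      unfolding small_dissections_eq[OF e01] using e assms(5) by simp
    have Q: "cond [1] [n - 1, 1] \<longleftrightarrow> ?Q"
    proof -
      have "(\<exists>i\<in>{2..M - 1}. n = t + i) \<longleftrightarrow> t + 2 \<le> n \<and> n < t + M"
        using M by (auto intro!: bexI[of _ "n - t"])
      then show ?thesis using ak by (simp add: cond_def t_def)
    qed
    have single: "{(ns, xs) \<in> {([1], ys)}. cond ns xs} = (if cond [1] ys then {([1], ys)} else {})"
      for ys by auto
    have "card {(ns, xs) \<in> ?S n. cond ns xs} = (if 1 < n \<and> ?Q then 1 else 0)"
    proof (cases "1 < n")
      case True
      then show ?thesis unfolding S if_P[OF True] single Q by simp
    next
      case False
      then show ?thesis unfolding S if_not_P[OF False] by simp
    qed
    then show ?thesis
      unfolding t(1) t_def[symmetric] card_small_dissections[OF e01] unfolding e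
      using t(2) M assms(5) by auto
  qed
  show ?thesis
    unfolding cond_def[symmetric]
    using lhs rhs large small unfolding total by (auto split: if_splits)
qed

end
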